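(* Let $q=p^e$ with $p$ an odd prime and $e\ge3$ odd. Let $f\in\mathcal{RF}$ with $\varepsilon$ the sign of its Walsh transform. Let $\beta$ be a generator of $\mathbb{F}_q^*$, let $d_1,\dots,d_q$ be the elements of $\mathbb{F}_q$ with $d_q=0$, and let $G_2$ be the $(e+2)\times q$ matrix with first row $(1,\dots,1)$, second row $(f(d_1)+1,\dots,f(d_q)+1)$, and $(i+3)$-th row $(\mathrm{Tr}_{q/p}(\beta^id_1),\dots,\mathrm{Tr}_{q/p}(\beta^id_q))$ for $0\le i\le e-1$. Let $\mathcal{C}_f'$ be the $p$-ary code generated by $G_2'=[I_{e+2}:G_2]$. If $\varepsilon(\eta_0(-1))^{(e+1)/2}=1$, then $\mathcal{C}_f'$ has parameters $[p^e+e+2,\ e+2,\ p^e-p^{e-1}-p^{\frac{e-1}{2}}+1]$; if $\varepsilon(\eta_0(-1))^{(e+1)/2}=-1$, then $\mathcal{C}_f'$ has parameters $[p^e+e+2,\ e+2,\ p^e-p^{e-1}-p^{\frac{e-1}{2}}+2]$. Moreover, $\mathcal{C}_f'^{\perp}$ has parameters $[p^e+e+2,\ p^e,\ 3]$ and is at least almost optimal according to the sphere-packing bound.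
   Context: $\zeta_p=e^{2\pi i/p}$; $\mathrm{Tr}_{q/p}$ is the trace map from $\mathbb{F}_q$ to $\mathbb{F}_p$; $\eta_0$ is the quadratic character of $\mathbb{F}_p$; $p^*=(-1)^{(p-1)/2}p$ with $\sqrt{p^*}=\sqrt p$ if $p\equiv1\pmod 4$ and $\sqrt{-1}\sqrt p$ otherwise. Walsh transform of $f:\mathbb{F}_{p^e}\to\mathbb{F}_p$: $W_f(\beta)=\sum_x\zeta_p^{f(x)-\mathrm{Tr}_{p^e/p}(\beta x)}$; $f$ is weakly regular bent with sign $\varepsilon\in\{\pm1\}$ and dual $f^*:\mathbb{F}_{p^e}\to\mathbb{F}_p$ if $W_f(\beta)=\varepsilon\sqrt{p^*}^e\zeta_p^{f^*(\beta)}$ for all $\beta$. $\mathcal{RF}$ is the set of weakly regular bent $f$ with $f(0)=0$ and $f(ax)=a^hf(x)$ for all $a\in\mathbb{F}_p^*$, $x$, for some positive even $h$ with $\gcd(h-1,p-1)=1$. "At least almost optimal according to the sphere-packing bound" means the sphere-packing bound rules out a code with the same length and dimension and minimum distance $d+2$. *)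

theory Defs
  imports Complex_Main "HOL-Number_Theory.Number_Theory"
begin

(* The finite field F_q is a type 'a :: {field, finite} with CARD('a) = p^e.
   F_p is realised as the prime subfield of 'a. *)

definition Fp :: "nat \<Rightarrow> 'a::{field,finite} set" where
  "Fp p = {of_nat k | k. k < p}"

definition fp_val :: "nat \<Rightarrow> 'a::{field,finite} \<Rightarrow> nat" where
  "fp_val p y = (THE k. k < p \<and> of_nat k = y)"

definition zeta_pow :: "nat \<Rightarrow> 'a::{field,finite} \<Rightarrow> complex" where
  "zeta_pow p y = cis (2 * pi * real (fp_val p y) / real p)"

definition tr :: "nat \<Rightarrow> nat \<Rightarrow> 'a::{field,finite} \<Rightarrow> 'a" where
  "tr p e x = (\<Sum>i<e. x ^ (p ^ i))"

definition walsh :: "nat \<Rightarrow> nat \<Rightarrow> ('a::{field,finite} \<Rightarrow> 'a) \<Rightarrow> 'a \<Rightarrow> complex" where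
  "walsh p e f \<beta> = (\<Sum>x\<in>UNIV. zeta_pow p (f x - tr p e (\<beta> * x)))"

definition sqrt_pstar :: "nat \<Rightarrow> complex" where
  "sqrt_pstar p = (if p mod 4 = 1 then complex_of_real (sqrt (real p))
                   else \<i> * complex_of_real (sqrt (real p)))"

definition weakly_regular_bent :: "nat \<Rightarrow> nat \<Rightarrow> ('a::{field,finite} \<Rightarrow> 'a) \<Rightarrow> int \<Rightarrow> bool" where
  "weakly_regular_bent p e f \<epsilon> \<longleftrightarrow>
     (\<forall>x. f x \<in> Fp p) \<and> (\<epsilon> = 1 \<or> \<epsilon> = -1) \<and>
     (\<exists>fstar :: 'a \<Rightarrow> 'a. (\<forall>b. fstar b \<in> Fp p) \<and>
        (\<forall>b. walsh p e f b = of_int \<epsilon> * sqrt_pstar p ^ e * zeta_pow p (fstar b)))"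

definition in_RF :: "nat \<Rightarrow> nat \<Rightarrow> ('a::{field,finite} \<Rightarrow> 'a) \<Rightarrow> bool" where
  "in_RF p e f \<longleftrightarrow>
     (\<exists>\<epsilon>. weakly_regular_bent p e f \<epsilon>) \<and> f 0 = 0 \<and>
     (\<exists>h::nat. h > 0 \<and> even h \<and> gcd (h - 1) (p - 1) = 1 \<and>
        (\<forall>a\<in>Fp p. a \<noteq> 0 \<longrightarrow> (\<forall>x. f (a * x) = a ^ h * f x)))"

definition eta0_neg1 :: "nat \<Rightarrow> int" where
  "eta0_neg1 p = Legendre (-1) (int p)"

definition words :: "nat \<Rightarrow> nat \<Rightarrow> (nat \<Rightarrow> 'a::{field,finite}) set" where
  "words p n = {c. (\<forall>j. c j \<in> Fp p) \<and> (\<forall>j\<ge>n. c j = 0)}"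

definition gen_code :: "nat \<Rightarrow> nat \<Rightarrow> nat \<Rightarrow> (nat \<Rightarrow> nat \<Rightarrow> 'a::{field,finite}) \<Rightarrow> (nat \<Rightarrow> 'a) set" where
  "gen_code p k n G = {(\<lambda>j. if j < n then (\<Sum>i<k. u i * G i j) else 0) | u. \<forall>i. u i \<in> Fp p}"

definition weight :: "nat \<Rightarrow> (nat \<Rightarrow> 'a::zero) \<Rightarrow> nat" where
  "weight n c = card {j. j < n \<and> c j \<noteq> 0}"

definition min_dist :: "nat \<Rightarrow> (nat \<Rightarrow> 'a::zero) set \<Rightarrow> nat" where
  "min_dist n C = Min {weight n c | c. c \<in> C \<and> c \<noteq> (\<lambda>_. 0)}"

definition dual_code :: "nat \<Rightarrow> nat \<Rightarrow> (nat \<Rightarrow> 'a::{field,finite}) set \<Rightarrow> (nat \<Rightarrow> 'a) set" where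
  "dual_code p n C = {v \<in> words p n. \<forall>c\<in>C. (\<Sum>j<n. v j * c j) = 0}"

(* C is a p-ary [n,k,d] linear code; dimension k over F_p means |C| = p^k *)
definition has_params :: "nat \<Rightarrow> (nat \<Rightarrow> 'a::{field,finite}) set \<Rightarrow> nat \<Rightarrow> nat \<Rightarrow> nat \<Rightarrow> bool" where
  "has_params p C n k d \<longleftrightarrow>
     C \<subseteq> words p n \<and> (\<forall>x\<in>C. \<forall>y\<in>C. (\<lambda>j. x j + y j) \<in> C) \<and>
     card C = p ^ k \<and> min_dist n C = d"

definition sphere_packing_excludes :: "nat \<Rightarrow> nat \<Rightarrow> nat \<Rightarrow> nat \<Rightarrow> bool" where
  "sphere_packing_excludes p n k d \<longleftrightarrow>
     p ^ k * (\<Sum>i\<le>(d - 1) div 2. (n choose i) * (p - 1) ^ i) > p ^ n"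

definition sp_almost_optimal :: "nat \<Rightarrow> nat \<Rightarrow> nat \<Rightarrow> nat \<Rightarrow> bool" where
  "sp_almost_optimal p n k d \<longleftrightarrow> sphere_packing_excludes p n k (d + 2)"

(* G_2 : rows 0..e+1, columns 0..q-1 (column j corresponds to d_{j+1}) *)
definition G2 :: "nat \<Rightarrow> nat \<Rightarrow> ('a::{field,finite} \<Rightarrow> 'a) \<Rightarrow> 'a \<Rightarrow> (nat \<Rightarrow> 'a) \<Rightarrow> nat \<Rightarrow> nat \<Rightarrow> 'a" where
  "G2 p e f \<beta> d i j =
     (if i = 0 then 1 else if i = 1 then f (d j) + 1 else tr p e (\<beta> ^ (i - 2) * d j))"

definition G2' :: "nat \<Rightarrow> nat \<Rightarrow> ('a::{field,finite} \<Rightarrow> 'a) \<Rightarrow> 'a \<Rightarrow> (nat \<Rightarrow> 'a) \<Rightarrow> nat \<Rightarrow> nat \<Rightarrow> 'a" where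
  "G2' p e f \<beta> d i j =
     (if j < e + 2 then (if i = j then 1 else 0) else G2 p e f \<beta> d i (j - (e + 2)))"

end

theory Submission
  imports Defs "HOL-Computational_Algebra.Polynomial_Factorial"
begin

text \<open>
  A code word is determined by a message \<open>(u\<^sub>0, u\<^sub>1, v)\<close>; it consists of the message followed by the values of
  \<open>u\<^sub>0 + u\<^sub>1 (f x + 1) + Tr (b x)\<close>, where \<open>b\<close> has coordinates \<open>v\<close> in the basis \<open>1, \<beta>, \<dots>, \<beta>\<^bsup>e-1\<^esup>\<close>. So one has
  to count the solutions of \<open>f x - Tr (b x) = t\<close>. The numbers \<open>n\<^sub>t\<close> of solutions satisfy
  \<open>\<Sum> n\<^sub>t \<zeta>\<^sup>t = W\<^sub>f(b)\<close>. Since \<open>e\<close> is odd and \<open>\<surd>p\<^sup>*\<close> is the quadratic Gauss sum, the right-hand side is also an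
  explicit integer combination of the \<open>\<zeta>\<^sup>t\<close>, and the only linear relation between these is
  \<open>\<Sum> \<zeta>\<^sup>t = 0\<close>. Hence \<open>n\<^sub>t\<close> differs from \<open>p\<^bsup>e-1\<^esup>\<close> by \<open>\<plusminus>p\<^bsup>(e-1)/2\<^esup>\<close> times the Legendre symbol of
  \<open>t - f\<^sup>*(b)\<close>. Two points decide which of the two minimum distances occurs: the sign of the Gauss sum, and
  \<open>f\<^sup>*(0) = 0\<close>. For the dual code one checks that the columns of the generator matrix are pairwise
  independent and exhibits three dependent ones.
\<close>

section \<open>The sign of the quadratic Gauss sum\<close>

text \<open>This is Gauss's proof. The alternating sum of the \<open>q\<close>-binomial coefficients of order \<open>p - 1\<close> is a product,
  and for a root of unity \<open>q\<close> of order \<open>p\<close> its terms become \<open>q\<^bsup>-j(j+1)/2\<^esup>\<close>, which after completing the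
  square is the Gauss sum.\<close>

fun q_binomial :: "'a::comm_ring_1 \<Rightarrow> nat \<Rightarrow> nat \<Rightarrow> 'a" where
  "q_binomial q n 0 = 1"
| "q_binomial q 0 (Suc k) = 0"
| "q_binomial q (Suc n) (Suc k) = q_binomial q n k + q ^ Suc k * q_binomial q n (Suc k)"

lemma q_binomial_eq_0: "n < k \<Longrightarrow> q_binomial q n k = 0"
  by (induction q n k rule: q_binomial.induct) auto

text \<open>Besides the Pascal rule in the definition there is this mirror image, with the power of
  \<open>q\<close> on the other term; comparing the two rules gives
  \<open>q_binomial_ratio\<close>.\<close>

lemma q_binomial_Suc_Suc':
  "k \<le> n \<Longrightarrow> q_binomial q (Suc n) (Suc k) = q ^ (n - k) * q_binomial q n k + q_binomial q n (Suc k)"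
proof (induction n arbitrary: k)
  case 0
  then show ?case by simp
next
  case (Suc n)
  show ?case
  proof (cases k)
    case 0
    have "q_binomial q (Suc (Suc n)) (Suc 0) = 1 + q * q_binomial q (Suc n) (Suc 0)"
      by simp
    also have "\<dots> = 1 + q * (q ^ n + q_binomial q n (Suc 0))"
      using Suc.IH[of 0] by simp
    also have "\<dots> = q ^ Suc n + q_binomial q (Suc n) (Suc 0)"
      by (simp add: algebra_simps)
    finally show ?thesis using 0 by simp
  next
    case (Suc k')
    with Suc.prems have k': "k' \<le> n" by simp
    have eq1: "q_binomial q (Suc n) (Suc k') = q ^ (n - k') * q_binomial q n k' + q_binomial q n (Suc k')"
      by (rule Suc.IH) fact
    \<comment> \<open>For \<open>k' = n\<close> the induction hypothesis does not apply, but then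
      all coefficients involved are zero.\<close>
    have eq2: "q ^ Suc (Suc k') * q_binomial q (Suc n) (Suc (Suc k')) =
               q ^ Suc n * q_binomial q n (Suc k') + q ^ Suc (Suc k') * q_binomial q n (Suc (Suc k'))"
    proof (cases "k' = n")
      case True
      then show ?thesis by (simp add: q_binomial_eq_0)
    next
      case False
      with k' have "Suc k' \<le> n" by simp
      have "q ^ Suc (Suc k') * q ^ (n - Suc k') = q ^ Suc n"
        unfolding power_add[symmetric] using \<open>Suc k' \<le> n\<close> by simp
      then show ?thesis
        by (subst Suc.IH[OF \<open>Suc k' \<le> n\<close>]) (simp add: distrib_left mult.assoc[symmetric])
    qed
    have eq3: "q ^ (n - k') * q ^ Suc k' = q ^ Suc n"
      unfolding power_add[symmetric] using k' by simp
    have "q_binomial q (Suc (Suc n)) (Suc (Suc k')) =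
        q_binomial q (Suc n) (Suc k') + q ^ Suc (Suc k') * q_binomial q (Suc n) (Suc (Suc k'))"
      by (rule q_binomial.simps(3))
    also have "\<dots> = q ^ (n - k') * q_binomial q n k' + q_binomial q n (Suc k') +
        (q ^ Suc n * q_binomial q n (Suc k') + q ^ Suc (Suc k') * q_binomial q n (Suc (Suc k')))"
      by (simp only: eq1 eq2)
    also have "\<dots> = q ^ (n - k') * (q_binomial q n k' + q ^ Suc k' * q_binomial q n (Suc k')) +
        (q_binomial q n (Suc k') + q ^ Suc (Suc k') * q_binomial q n (Suc (Suc k')))"
      unfolding eq3[symmetric] by (simp only: algebra_simps)
    also have "\<dots> = q ^ (n - k') * q_binomial q (Suc n) (Suc k') + q_binomial q (Suc n) (Suc (Suc k'))"
      by (simp only: q_binomial.simps(3))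
    finally show ?thesis using Suc by simp
  qed
qed

text \<open>Both Pascal rules expand the same coefficient, and equating them relates neighbours.
  There is no division, because \<open>1 - q ^ Suc k\<close> can vanish at a root of unity.\<close>

lemma q_binomial_ratio:
  assumes "k \<le> n"
  shows "(1 - q ^ Suc k) * q_binomial q n (Suc k) = (1 - q ^ (n - k)) * q_binomial q n k"
  using q_binomial_Suc_Suc'[OF assms, of q] by (simp add: algebra_simps)

definition alt_q_sum :: "'a::comm_ring_1 \<Rightarrow> nat \<Rightarrow> 'a" where
  "alt_q_sum q n = (\<Sum>j\<le>n. (-1) ^ j * q_binomial q n j)"

text \<open>A companion of \<open>alt_q_sum\<close>: the pair satisfies a first-order recursion in
  \<open>n\<close>.\<close>

definition alt_q_sum' :: "'a::comm_ring_1 \<Rightarrow> nat \<Rightarrow> 'a" where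
  "alt_q_sum' q n = (\<Sum>j\<le>n. (-1) ^ j * q ^ j * q_binomial q n j)"

lemma alt_q_sum_Suc: "alt_q_sum q (Suc n) = alt_q_sum' q n - alt_q_sum q n"
proof -
  have "alt_q_sum q (Suc n) = 1 + (\<Sum>j\<le>n. (-1) ^ Suc j * q_binomial q (Suc n) (Suc j))"
    unfolding alt_q_sum_def by (subst sum.atMost_Suc_shift) simp
  also have "\<dots> = 1 + (\<Sum>j\<le>n. (-1) ^ Suc j * q ^ Suc j * q_binomial q n (Suc j)) - alt_q_sum q n"
    unfolding alt_q_sum_def by (simp add: distrib_left sum.distrib sum_subtractf sum_negf mult.assoc)
  also have "1 + (\<Sum>j\<le>n. (-1) ^ Suc j * q ^ Suc j * q_binomial q n (Suc j)) =
      (\<Sum>j\<le>Suc n. (-1) ^ j * q ^ j * q_binomial q n j)"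
    by (subst sum.atMost_Suc_shift) simp
  also have "\<dots> = alt_q_sum' q n"
    by (simp add: alt_q_sum'_def q_binomial_eq_0)
  finally show ?thesis .
qed

text \<open>The mirror Pascal rule fits here: \<open>q ^ Suc j * q ^ (n - j)\<close> is the same for
  every \<open>j\<close> and factors out.\<close>

lemma alt_q_sum'_Suc: "alt_q_sum' q (Suc n) = alt_q_sum' q n - q ^ Suc n * alt_q_sum q n"
proof -
  have "alt_q_sum' q (Suc n) = 1 + (\<Sum>j\<le>n. (-1) ^ Suc j * q ^ Suc j * q_binomial q (Suc n) (Suc j))"
    unfolding alt_q_sum'_def by (subst sum.atMost_Suc_shift) simp
  also have "(\<Sum>j\<le>n. (-1) ^ Suc j * q ^ Suc j * q_binomial q (Suc n) (Suc j)) =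
     (\<Sum>j\<le>n. (-1) ^ Suc j * q ^ Suc j * q_binomial q n (Suc j) -
             q ^ Suc n * ((-1) ^ j * q_binomial q n j))"
  proof (rule sum.cong[OF refl])
    fix j assume "j \<in> {..n}"
    then have j: "j \<le> n" by simp
    have "q ^ Suc j * q ^ (n - j) = q ^ Suc n"
      unfolding power_add[symmetric] using j by simp
    then show "(-1) ^ Suc j * q ^ Suc j * q_binomial q (Suc n) (Suc j) =
        (-1) ^ Suc j * q ^ Suc j * q_binomial q n (Suc j) -
             q ^ Suc n * ((-1) ^ j * q_binomial q n j)"
      unfolding q_binomial_Suc_Suc'[OF j]
      by (simp add: distrib_left mult_ac del: power_Suc) (simp add: mult_ac)
  qed
  also have "1 + \<dots> = 1 + (\<Sum>j\<le>n. (-1) ^ Suc j * q ^ Suc j * q_binomial q n (Suc j))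
      - q ^ Suc n * alt_q_sum q n"
    by (simp only: sum_subtractf alt_q_sum_def sum_distrib_left) simp
  also have "1 + (\<Sum>j\<le>n. (-1) ^ Suc j * q ^ Suc j * q_binomial q n (Suc j)) =
      (\<Sum>j\<le>Suc n. (-1) ^ j * q ^ j * q_binomial q n j)"
    by (subst sum.atMost_Suc_shift) simp
  also have "\<dots> = alt_q_sum' q n"
    by (simp add: alt_q_sum'_def q_binomial_eq_0)
  finally show ?thesis .
qed

text \<open>Eliminating the companion sum gives
  \<open>alt_q_sum q (n + 2) = (1 - q ^ (n + 1)) * alt_q_sum q n\<close>.\<close>

lemma alt_q_sum_even: "alt_q_sum q (2 * m) = (\<Prod>i<m. 1 - q ^ (2 * i + 1))"
proof (induction m)
  case 0
  then show ?case by (simp add: alt_q_sum_def)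
next
  case (Suc m)
  have "alt_q_sum q (2 * Suc m) = (1 - q ^ (2 * m + 1)) * alt_q_sum q (2 * m)"
    by (simp add: alt_q_sum_Suc alt_q_sum'_Suc algebra_simps)
  then show ?case using Suc by simp
qed

section \<open>Additive characters modulo p and the evaluation of the Gauss sum\<close>

definition e_mod :: "nat \<Rightarrow> int \<Rightarrow> complex" where
  "e_mod p k = cis (2 * pi * of_int k / of_nat p)"

lemma e_mod_0 [simp]: "e_mod p 0 = 1"
  by (simp add: e_mod_def)

lemma e_mod_add: "e_mod p (a + b) = e_mod p a * e_mod p b"
  by (simp add: e_mod_def cis_mult add_divide_distrib distrib_left)

lemma e_mod_minus: "e_mod p (- a) = inverse (e_mod p a)"
  by (simp add: e_mod_def)

lemma e_mod_diff: "e_mod p (a - b) = e_mod p a / e_mod p b"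
  using e_mod_add[of p a "- b"] by (simp add: e_mod_minus divide_inverse)

lemma e_mod_nonzero [simp]: "e_mod p a \<noteq> 0"
  by (simp add: e_mod_def)

lemma e_mod_power: "e_mod p a ^ n = e_mod p (int n * a)"
  by (induction n) (simp_all add: e_mod_add algebra_simps)

lemma cnj_e_mod: "cnj (e_mod p a) = e_mod p (- a)"
  by (simp add: e_mod_def cis_cnj)

lemma e_mod_eq_1_iff:
  assumes "p > 0"
  shows "e_mod p a = 1 \<longleftrightarrow> int p dvd a"
proof
  assume "int p dvd a"
  then obtain b where "a = int p * b" by blast
  then have "2 * pi * of_int a / of_nat p = 2 * pi * of_int b" using assms by simp
  then show "e_mod p a = 1" unfolding e_mod_def by (simp only: cis_multiple_2pi Ints_of_int)
next
  assume "e_mod p a = 1"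
  then have "cos (2 * pi * of_int a / of_nat p) = 1"
    by (simp add: e_mod_def complex_eq_iff)
  then obtain n :: int where "2 * pi * of_int a / of_nat p = of_int n * 2 * pi"
    using cos_one_2pi_int by auto
  then have "real_of_int a = of_int (n * int p)"
    using assms by (simp add: field_simps)
  then have "a = n * int p" by linarith
  then show "int p dvd a" by simp
qed

lemma e_mod_cong:
  assumes "p > 0" "[a = b] (mod int p)"
  shows "e_mod p a = e_mod p b"
proof -
  have "e_mod p (a - b) = 1"
    using assms by (subst e_mod_eq_1_iff) (auto simp: cong_iff_dvd_diff)
  then show ?thesis by (simp add: e_mod_diff)
qed

text \<open>Translation permutes the residues. This serves to complete squares and to re-index
  Legendre sums.\<close>

lemma sum_mod_shift:
  fixes g :: "int \<Rightarrow> 'b::comm_monoid_add"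
  assumes "n > 0" "\<And>a b. [a = b] (mod n) \<Longrightarrow> g a = g b"
  shows "(\<Sum>j\<in>{0..<n}. g (j + c)) = (\<Sum>j\<in>{0..<n}. g j)"
proof (rule sum.reindex_bij_witness[where i = "\<lambda>j. (j - c) mod n" and j = "\<lambda>j. (j + c) mod n"])
  fix j assume "j \<in> {0..<n}"
  then show "((j + c) mod n - c) mod n = j" "((j - c) mod n + c) mod n = j"
    by (simp_all add: mod_simps)
  show "(j + c) mod n \<in> {0..<n}" "(j - c) mod n \<in> {0..<n}" using assms by simp_all
  show "g ((j + c) mod n) = g (j + c)" by (rule assms(2)) simp
qed

text \<open>Orthogonality of characters: shifting \<open>j\<close> by 1 multiplies the sum by
  \<open>e_mod p k\<close>, so it vanishes unless this factor is 1.\<close>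

lemma sum_e_mod:
  assumes "p > 0"
  shows "(\<Sum>j\<in>{0..<int p}. e_mod p (k * j)) = (if int p dvd k then of_nat p else 0)"
proof (cases "int p dvd k")
  case True
  then have "e_mod p (k * j) = 1" for j
    using assms by (subst e_mod_eq_1_iff) auto
  then show ?thesis using True by simp
next
  case False
  let ?S = "\<Sum>j\<in>{0..<int p}. e_mod p (k * j)"
  have "?S = (\<Sum>j\<in>{0..<int p}. e_mod p (k * (j + 1)))"
    using assms by (intro sum_mod_shift[symmetric] e_mod_cong cong_mult) auto
  also have "\<dots> = e_mod p k * ?S"
    by (simp add: distrib_left e_mod_add sum_distrib_left mult.commute)
  finally have "(1 - e_mod p k) * ?S = 0" by (simp add: algebra_simps)
  moreover have "e_mod p k \<noteq> 1" using False assms by (simp add: e_mod_eq_1_iff)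
  ultimately show ?thesis using False by simp
qed

lemma sum_int_atLeastLessThan: "(\<Sum>j\<in>{0..<int n}. g j) = (\<Sum>j<n. g (int j))"
proof -
  have "{0..<int n} = int ` {..<n}"
    using image_int_atLeastLessThan[of 0 n] by (simp add: lessThan_atLeast0)
  then show ?thesis by (simp add: sum.reindex)
qed

definition quad_sum :: "nat \<Rightarrow> complex" where
  "quad_sum p = (\<Sum>j\<in>{0..<int p}. e_mod p (j\<^sup>2))"

text \<open>In the double sum for the squared norm, replacing \<open>j\<close> by
  \<open>j + k\<close> turns the exponent into \<open>j\<^sup>2 + 2 * j * k\<close>. The sum over
  \<open>k\<close> then vanishes unless \<open>j = 0\<close>, as 2 is invertible modulo the odd
  \<open>p\<close>.\<close>

lemma norm_quad_sum:
  assumes "p > 0" "odd p"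
  shows "norm (quad_sum p) = sqrt p"
proof -
  let ?I = "{0..<int p}"
  have "complex_of_real ((norm (quad_sum p))\<^sup>2) = quad_sum p * cnj (quad_sum p)"
    by (rule complex_norm_square)
  also have "\<dots> = (\<Sum>k\<in>?I. \<Sum>j\<in>?I. e_mod p (j\<^sup>2 - k\<^sup>2))"
    unfolding quad_sum_def
    by (subst sum.swap) (simp add: sum_product cnj_e_mod e_mod_add[symmetric])
  also have "\<dots> = (\<Sum>k\<in>?I. \<Sum>j\<in>?I. e_mod p ((j + k)\<^sup>2 - k\<^sup>2))"
    using assms by (intro sum.cong refl sum_mod_shift[symmetric] e_mod_cong cong_diff cong_pow) auto
  also have "\<dots> = (\<Sum>j\<in>?I. \<Sum>k\<in>?I. e_mod p (j\<^sup>2) * e_mod p (2 * j * k))"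
    by (subst sum.swap) (simp add: e_mod_add[symmetric] power2_eq_square algebra_simps)
  also have "\<dots> = (\<Sum>j\<in>?I. if j = 0 then of_nat p else 0)"
  proof (rule sum.cong[OF refl])
    fix j assume j: "j \<in> ?I"
    have "int p dvd 2 * j \<longleftrightarrow> int p dvd j"
      using assms by (intro coprime_dvd_mult_right_iff) (simp add: coprime_commute)
    also have "\<dots> \<longleftrightarrow> j = 0" using j by (auto dest: zdvd_imp_le)
    finally show "(\<Sum>k\<in>?I. e_mod p (j\<^sup>2) * e_mod p (2 * j * k)) = (if j = 0 then of_nat p else 0)"
      using assms by (simp add: sum_distrib_left[symmetric] sum_e_mod)
  qed
  also have "\<dots> = complex_of_real (real p)" using assms by simp
  finally have "(norm (quad_sum p))\<^sup>2 = real p" by (simp only: of_real_eq_iff)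
  then show ?thesis by (metis norm_ge_zero real_sqrt_unique)
qed

text \<open>Since \<open>q = e_mod p (-2)\<close> has \<open>q ^ p = 1\<close>, the ratio formula
  has numerator \<open>1 - q ^ (-(j + 1))\<close>, and each new coefficient arises from the previous
  one by the factor \<open>- e_mod p (2 * (j + 1))\<close>. The choice of -2 avoids halving
  \<open>j * (j + 1)\<close>.\<close>

lemma alt_q_binomial_e_mod:
  assumes "prime p" "odd p" "j \<le> p - 1"
  shows "(-1) ^ j * q_binomial (e_mod p (-2)) (p - 1) j = e_mod p (int j * (int j + 1))"
  using assms(3)
proof (induction j)
  case 0
  then show ?case by simp
next
  case (Suc j)
  let ?q = "e_mod p (-2)"
  let ?b = "q_binomial ?q (p - 1)"
  have p: "p > 0" using assms prime_gt_0_nat by blast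
  have "\<not> int p dvd int (Suc j) * 2"
  proof -
    have "\<not> p dvd Suc j * 2"
      using assms Suc.prems p
      by (metis One_nat_def Suc_pred coprime_dvd_mult_left_iff coprime_right_2_iff_odd 
          dvd_imp_le not_less_eq_eq zero_less_Suc)
    then show ?thesis by (metis int_dvd_int_iff of_nat_mult of_nat_numeral)
  qed
  then have ne: "1 - ?q ^ Suc j \<noteq> 0"
    using p by (simp add: e_mod_power e_mod_eq_1_iff del: power_Suc of_nat_Suc)
  have inv: "?q ^ (p - 1 - j) = e_mod p (2 * int (Suc j))"
    unfolding e_mod_power
  proof (rule e_mod_cong[OF p])
    have "int (p - 1 - j) * -2 - 2 * int (Suc j) = int p * (-2)"
      using Suc.prems p by (simp add: algebra_simps)
    then show "[int (p - 1 - j) * - 2 = 2 * int (Suc j)] (mod int p)"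
      unfolding cong_iff_dvd_diff by (metis dvd_triv_left)
  qed
  have q: "?q ^ Suc j * e_mod p (2 * int (Suc j)) = 1"
    unfolding e_mod_power by (simp add: e_mod_add[symmetric] mult.commute)
  have "(1 - ?q ^ Suc j) * ?b (Suc j) = (1 - e_mod p (2 * int (Suc j))) * ?b j"
    using q_binomial_ratio[of j "p - 1" ?q] Suc.prems inv by simp
  also have "(1 - e_mod p (2 * int (Suc j))) = (1 - ?q ^ Suc j) * (- e_mod p (2 * int (Suc j)))"
    using q by (simp add: algebra_simps del: power_Suc of_nat_Suc)
  finally have "?b (Suc j) = - e_mod p (2 * int (Suc j)) * ?b j"
    using ne by (metis (no_types, lifting) mult.assoc mult_left_cancel)
  then have "(-1) ^ Suc j * ?b (Suc j) = e_mod p (2 * int (Suc j)) * ((-1) ^ j * ?b j)"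
    by simp
  also have "\<dots> = e_mod p (int (Suc j) * (int (Suc j) + 1))"
    using Suc by (simp add: e_mod_add[symmetric] algebra_simps)
  finally show ?case .
qed

text \<open>Each factor \<open>1 - e_mod p (-2 * a)\<close> of Gauss's product is a phase
  \<open>e_mod p (- a)\<close> times \<open>2 * \<i>\<close> times a sine. The phases cancel against
  the constant from completing the square.\<close>

lemma quad_sum_eq_prod_sin:
  assumes "prime p" "odd p"
  shows "quad_sum p = \<i> ^ ((p - 1) div 2) *
    of_real (\<Prod>i<(p - 1) div 2. 2 * sin (2 * pi * real (2 * i + 1) / real p))"
proof -
  have p: "p > 0" using assms prime_gt_0_nat by blast
  define m where "m = (p - 1) div 2"
  have pm: "p = 2 * m + 1" using assms p unfolding m_def by presburger
  have "(\<Sum>j\<in>{0..<int p}. e_mod p (j * (j + 1))) = alt_q_sum (e_mod p (-2)) (2 * m)"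
    unfolding alt_q_sum_def sum_int_atLeastLessThan
    using pm alt_q_binomial_e_mod[OF assms]
    by (intro sum.cong) auto
  also have "\<dots> = (\<Prod>i<m. 1 - e_mod p (-2 * int (2 * i + 1)))"
    by (simp only: alt_q_sum_even e_mod_power mult.commute[of "-2"])
  also have "\<dots> = (\<Prod>i<m. e_mod p (- int (2 * i + 1)) * (\<i> * of_real (2 * sin (2 * pi * real (2 * i + 1) / real p))))"
  proof (rule prod.cong[OF refl])
    fix i
    let ?a = "int (2 * i + 1)"
    have "e_mod p ?a - e_mod p (- ?a) = \<i> * of_real (2 * sin (2 * pi * real (2 * i + 1) / real p))"
      unfolding e_mod_def of_int_minus mult_minus_right minus_divide_left[symmetric]
      by (simp add: complex_eq_iff)
    moreover have "1 - e_mod p (- 2 * ?a) = e_mod p (- ?a) * (e_mod p ?a - e_mod p (- ?a))"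
      by (simp add: right_diff_distrib e_mod_add[symmetric])
    ultimately show "1 - e_mod p (- 2 * ?a) = 
        e_mod p (- ?a) * (\<i> * of_real (2 * sin (2 * pi * real (2 * i + 1) / real p)))" by simp
  qed
  also have "\<dots> = (\<Prod>i<m. e_mod p (- int (2 * i + 1))) *
      (\<i> ^ m * of_real (\<Prod>i<m. 2 * sin (2 * pi * real (2 * i + 1) / real p)))"
    by (simp add: prod.distrib)
  \<comment> \<open>The first \<open>m\<close> odd numbers add up to the square of
    \<open>m\<close>.\<close>
  also have "(\<Prod>i<m. e_mod p (- int (2 * i + 1))) = e_mod p (- (int m)\<^sup>2)"
    by (induction m) (simp_all add: e_mod_add[symmetric] power2_eq_square algebra_simps)
  finally have prod: "(\<Sum>j\<in>{0..<int p}. e_mod p (j * (j + 1))) = e_mod p (- (int m)\<^sup>2) *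
      (\<i> ^ m * of_real (\<Prod>i<m. 2 * sin (2 * pi * real (2 * i + 1) / real p)))" .
  \<comment> \<open>As \<open>p = 2 * m + 1\<close>, the number \<open>m + 1\<close> is the inverse
    of 2 modulo \<open>p\<close>, so this shift produces the linear term of
    \<open>j * (j + 1)\<close>.\<close>
  have "quad_sum p = (\<Sum>j\<in>{0..<int p}. e_mod p ((j + int (m + 1))\<^sup>2))"
    unfolding quad_sum_def using p by (intro sum_mod_shift[symmetric] e_mod_cong cong_pow) auto
  also have "\<dots> = (\<Sum>j\<in>{0..<int p}. e_mod p ((int m)\<^sup>2) * e_mod p (j * (j + 1)))"
  proof (rule sum.cong[OF refl])
    fix j
    have "(j + int (m + 1))\<^sup>2 - ((int m)\<^sup>2 + j * (j + 1)) = int p * (j + 1)"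
      by (simp add: pm power2_eq_square algebra_simps)
    then have "[(j + int (m + 1))\<^sup>2 = (int m)\<^sup>2 + j * (j + 1)] (mod int p)"
      unfolding cong_iff_dvd_diff by (metis dvd_triv_left)
    from e_mod_cong[OF p this]
    show "e_mod p ((j + int (m + 1))\<^sup>2) = e_mod p ((int m)\<^sup>2) * e_mod p (j * (j + 1))"
      by (simp add: e_mod_add)
  qed
  also have "\<dots> = e_mod p ((int m)\<^sup>2) * (\<Sum>j\<in>{0..<int p}. e_mod p (j * (j + 1)))"
    by (simp add: sum_distrib_left)
  finally show ?thesis unfolding prod m_def[symmetric] by (simp add: e_mod_minus)
qed

text \<open>The angles increase and stay below two pi; they exceed pi exactly for the last
  \<open>p div 4\<close> indices, which contribute the negative factors.\<close>

lemma prod_sin_sign: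
  assumes "prime p" "odd p"
  shows "\<exists>R>0. (\<Prod>i<(p - 1) div 2. 2 * sin (2 * pi * real (2 * i + 1) / real p)) = (-1) ^ (p div 4) * R"
proof -
  have p: "p > 0" using assms prime_gt_0_nat by blast
  define m where "m = (p - 1) div 2"
  define k where "k = p div 4"
  let ?s = "\<lambda>i. 2 * sin (2 * pi * real (2 * i + 1) / real p)"
  have pm: "p = 2 * m + 1" using assms p unfolding m_def by presburger
  have mk: "m = 2 * k \<or> m = 2 * k + 1" unfolding k_def pm by presburger
  have pos: "?s i > 0" if "i < m - k" for i
  proof -
    have "2 * real (2 * i + 1) < real p" using that pm mk by auto
    then have "pi * (2 * real (2 * i + 1)) < pi * real p" by simp
    then have "2 * pi * real (2 * i + 1) / real p < pi"
      using p by (simp add: divide_less_eq mult_ac del: of_nat_add of_nat_mult)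
    moreover have "2 * pi * real (2 * i + 1) / real p > 0" using p by simp
    ultimately show ?thesis using sin_gt_zero by simp
  qed
  have neg: "- ?s i > 0" if "i \<in> {m - k..<m}" for i
  proof -
    have "2 * real (2 * i + 1) > real p" "real (2 * i + 1) < real p" using that pm mk by auto
    then have "pi * (2 * real (2 * i + 1)) > pi * real p" "pi * real (2 * i + 1) < pi * real p"
      by simp_all
    then have "2 * pi * real (2 * i + 1) / real p > pi" "2 * pi * real (2 * i + 1) / real p < 2 * pi"
      using p by (simp_all add: less_divide_eq divide_less_eq mult_ac del: of_nat_add of_nat_mult)
    then have "sin (2 * pi * real (2 * i + 1) / real p) < 0" by (rule sin_lt_zero)
    then show ?thesis by simp
  qed
  have "(\<Prod>i<m. ?s i) = (\<Prod>i<m - k. ?s i) * (\<Prod>i\<in>{m - k..<m}. ?s i)"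
    by (subst prod.union_disjoint[symmetric]) (auto simp: ivl_disj_un)
  also have "(\<Prod>i\<in>{m - k..<m}. ?s i) = (\<Prod>i\<in>{m - k..<m}. (-1) * - ?s i)" by simp
  also have "\<dots> = (-1) ^ k * (\<Prod>i\<in>{m - k..<m}. - ?s i)"
    using mk by (subst prod.distrib) auto
  finally have "(\<Prod>i<m. ?s i) = (-1) ^ k * ((\<Prod>i<m - k. ?s i) * (\<Prod>i\<in>{m - k..<m}. - ?s i))"
    by (simp only: mult_ac)
  moreover have "(\<Prod>i<m - k. ?s i) * (\<Prod>i\<in>{m - k..<m}. - ?s i) > 0"
    using pos neg by (intro mult_pos_pos prod_pos) auto
  ultimately show ?thesis unfolding m_def k_def by blast
qed

text \<open>The sine product leaves a positive factor undetermined, and the norm identifies it as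
  \<open>sqrt p\<close>. The signs from \<open>\<i> ^ m\<close> and \<open>(-1) ^ k\<close> cancel,
  leaving 1 or \<open>\<i>\<close> according to the parity of \<open>m\<close>.\<close>

theorem quad_sum_eq:
  assumes "prime p" "odd p"
  shows "quad_sum p = sqrt_pstar p"
proof -
  have p: "p > 0" using assms prime_gt_0_nat by blast
  define m where "m = (p - 1) div 2"
  define k where "k = p div 4"
  obtain R where R: "R > 0" 
    "(\<Prod>i<m. 2 * sin (2 * pi * real (2 * i + 1) / real p)) = (-1) ^ k * R"
    using prod_sin_sign[OF assms] unfolding m_def k_def by blast
  have eq: "quad_sum p = \<i> ^ m * of_real ((-1) ^ k * R)"
    using quad_sum_eq_prod_sin[OF assms] unfolding m_def[symmetric] R(2) .
  then have "norm (quad_sum p) = R" using R(1) by (simp add: norm_mult norm_power)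
  then have "R = sqrt p" using norm_quad_sum[OF p assms(2)] by simp
  show ?thesis
  proof (cases "p mod 4 = 1")
    case True
    then have "m = 2 * k" unfolding m_def k_def by presburger
    then show ?thesis using True eq \<open>R = sqrt p\<close>
      by (simp add: sqrt_pstar_def power_mult power_mult_distrib[symmetric] flip: mult.assoc)
  next
    case False
    then have "m = Suc (2 * k)" using assms unfolding m_def k_def by presburger
    then show ?thesis using False eq \<open>R = sqrt p\<close>
      by (simp add: sqrt_pstar_def power_mult power_mult_distrib[symmetric] flip: mult.assoc)
  qed
qed

section \<open>Linear relations between roots of unity of prime order\<close>

text \<open>For prime \<open>n\<close> this is the \<open>n\<close>-th cyclotomic
  polynomial.\<close>

definition all_ones_poly :: "nat \<Rightarrow> 'a::comm_ring_1 poly" where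
  "all_ones_poly n = (\<Sum>i<n. monom 1 i)"

lemma poly_all_ones_poly: "poly (all_ones_poly n) x = (\<Sum>i<n. x ^ i)"
  by (simp add: all_ones_poly_def poly_sum poly_monom)

lemma coeff_all_ones_poly: "coeff (all_ones_poly n) i = (if i < n then 1 else 0)"
  by (simp add: all_ones_poly_def coeff_sum)

lemma degree_all_ones_poly: "degree (all_ones_poly n :: 'a::comm_ring_1 poly) = n - 1"
proof (cases n)
  case 0
  then show ?thesis by (simp add: all_ones_poly_def)
next
  case (Suc m)
  show ?thesis
  proof (rule antisym)
    show "degree (all_ones_poly n :: 'a poly) \<le> n - 1"
      by (rule degree_le) (auto simp: coeff_all_ones_poly)
    show "n - 1 \<le> degree (all_ones_poly n :: 'a poly)"
      by (rule le_degree) (auto simp: coeff_all_ones_poly Suc)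
  qed
qed

lemma all_ones_poly_nonzero: "n > 0 \<Longrightarrow> all_ones_poly n \<noteq> (0 :: 'a::comm_ring_1 poly)"
  by (metis coeff_0 coeff_all_ones_poly zero_neq_one)

text \<open>Multiplied by X - 1 the left side becomes X^p - 1, which is (X - 1)^p by the Frobenius
  identity; then X - 1 is cancelled.\<close>

lemma all_ones_poly_char_p:
  assumes "CHAR('a::field) = p" "prime p"
  shows "all_ones_poly p = [:-1, 1::'a:] ^ (p - 1)"
proof -
  have p: "p > 0" using assms(2) prime_gt_0_nat by blast
  have X: "monom (1::'a) i = [:0, 1:] ^ i" for i by (simp add: monom_altdef)
  have "[:-1, 1::'a:] * all_ones_poly p = [:0, 1:] ^ p - 1"
    unfolding all_ones_poly_def X
    using power_diff_1_eq[of "[:0, 1::'a:]" p] by (simp add: one_pCons)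
  also have "\<dots> = [:-1, 1:] ^ p"
  proof -
    have ch: "CHAR('a poly) = p" using assms by simp
    have "([:-1, 1::'a:] + 1) ^ p = [:-1, 1:] ^ p + 1 ^ p"
      using freshmans_dream[where x = "[:-1, 1::'a:]" and y = 1] ch assms(2) by simp
    moreover have "[:-1, 1::'a:] + 1 = [:0, 1:]" by (simp add: one_pCons)
    ultimately show ?thesis by simp
  qed
  also have "\<dots> = [:-1, 1:] * [:-1, 1:] ^ (p - 1)"
    using p by (metis Suc_pred' power_Suc)
  finally show ?thesis by (metis mult_left_cancel one_neq_zero pCons_eq_0_iff)
qed

lemma content_all_ones_poly: "n > 0 \<Longrightarrow> content (all_ones_poly n :: int poly) = 1"
proof -
  assume "n > 0"
  then have "content (all_ones_poly n :: int poly) dvd 1"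
    using content_dvd_coeff[of "all_ones_poly n :: int poly" 0] by (simp add: coeff_all_ones_poly)
  then show ?thesis by (metis is_unit_normalize normalize_content)
qed

text \<open>Eisenstein's argument: modulo \<open>p\<close> both factors are powers of \<open>X - 1\<close>, so two non-constant
  factors would force \<open>p\<^sup>2\<close> to divide the value \<open>p\<close> at \<open>1\<close>. The reduction takes place in any field
  \<open>'a\<close> of characteristic \<open>p\<close>, which is the only role of that type here and in the next two lemmas.\<close>

lemma all_ones_poly_factor:
  fixes A B :: "int poly"
  assumes "CHAR('a::field) = p" "prime p" "all_ones_poly p = A * B"
  shows "degree A = 0 \<or> degree B = 0"
proof (rule ccontr)
  assume "\<not> ?thesis"
  then have dA: "degree A > 0" and dB: "degree B > 0" by auto
  have p: "p > 0" using assms(2) prime_gt_0_nat by blast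
  let ?h = "map_poly (of_int :: int \<Rightarrow> 'a)"
  have hom: "?h (all_ones_poly p) = all_ones_poly p"
    by (intro poly_eqI) (simp add: coeff_map_poly coeff_all_ones_poly)
  have mult: "?h (A * B) = ?h A * ?h B"
    by (intro poly_eqI) (simp add: coeff_map_poly coeff_mult)
  have prod: "?h A * ?h B = [:-1, 1:] ^ (p - 1)"
    using hom mult assms(3) all_ones_poly_char_p[OF assms(1,2)] by simp
  then have ne: "?h A * ?h B \<noteq> 0" by simp
  \<comment> \<open>The orders at 1 add up to the sum of the degrees of \<open>A\<close> and
    \<open>B\<close>, while neither order exceeds its degree. So both are equalities, and 1 is a
    root of both reductions.\<close>
  have "order 1 (?h A) + order 1 (?h B) = p - 1"
    using order_mult[OF ne, of 1] order_power_n_n[of "1::'a" "p - 1"] prod by simp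
  moreover have "degree A + degree B = p - 1"
  proof -
    have "A \<noteq> 0" "B \<noteq> 0" using dA dB by auto
    then show ?thesis using assms(3) degree_all_ones_poly[of p, where 'a = int] by (simp add: degree_mult_eq)
  qed
  moreover have "degree (?h C) \<le> degree C" for C
    by (rule degree_le) (simp add: coeff_map_poly coeff_eq_0)
  then have "order 1 (?h A) \<le> degree A" "order 1 (?h B) \<le> degree B"
    using order_degree[of "?h A" 1] order_degree[of "?h B" 1] ne by (auto intro: order_trans)
  ultimately have "order 1 (?h A) > 0" "order 1 (?h B) > 0" using dA dB by linarith+
  then have "poly (?h A) 1 = 0" "poly (?h B) 1 = 0"
    by (metis order_root less_irrefl)+
  moreover have "poly (?h C) 1 = of_int (poly C 1)" for C
    by (induction C) (simp_all add: map_poly_pCons)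
  ultimately have "int p dvd poly A 1" "int p dvd poly B 1"
    using assms(1) by (auto simp: of_int_eq_0_iff_char_dvd)
  then have "int p * int p dvd poly A 1 * poly B 1" by (rule mult_dvd_mono)
  also have "poly A 1 * poly B 1 = int p"
    using assms(3) poly_all_ones_poly[of p "1::int"] by simp
  finally have "int p * int p dvd int p" .
  then have "p * p dvd p" by (metis int_dvd_int_iff of_nat_mult)
  then show False using p assms(2) by (metis dvd_times_left_cancel_iff mult.right_neutral nat_dvd_1_iff_1 not_prime_1 less_numeral_extra(3))
qed

text \<open>The cyclotomic polynomial is irreducible over the integers. An annihilator
  \<open>M\<close> of least degree divides a multiple of it by pseudo-division; Gauss's lemma
  removes the multiplier, and irreducibility makes the cofactor constant.\<close>

lemma root_of_unity_degree:
  fixes A :: "int poly" and z :: complex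
  assumes "CHAR('a::field) = p" "prime p" "z ^ p = 1" "z \<noteq> 1"
    and "poly (map_poly of_int A) z = 0" "A \<noteq> 0"
  shows "degree A \<ge> p - 1"
proof -
  have p: "p > 0" using assms(2) prime_gt_0_nat by blast
  let ?h = "map_poly (of_int :: int \<Rightarrow> complex)"
  let ?P = "\<lambda>A::int poly. A \<noteq> 0 \<and> poly (?h A) z = 0"
  have mult: "?h (C * D) = ?h C * ?h D" for C D
    by (intro poly_eqI) (simp add: coeff_map_poly coeff_mult)
  have diff: "?h (C - D) = ?h C - ?h D" for C D
    by (intro poly_eqI) (simp add: coeff_map_poly)
  have smult: "?h (smult c D) = smult (of_int c) (?h D)" for c D
    by (intro poly_eqI) (simp add: coeff_map_poly)
  obtain M where M: "?P M" and min: "\<And>B. ?P B \<Longrightarrow> degree M \<le> degree B"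
    using ex_has_least_nat[of ?P A degree] assms by blast
  have hones: "?h (all_ones_poly p) = all_ones_poly p"
    by (intro poly_eqI) (simp add: coeff_map_poly coeff_all_ones_poly)
  have Phi: "poly (?h (all_ones_poly p)) z = 0"
    unfolding hones poly_all_ones_poly using assms(3,4) power_diff_1_eq[of z p] by simp
  \<comment> \<open>Pseudo-division keeps integer coefficients at the price of a scalar
    \<open>a\<close>.\<close>
  define r where "r = pseudo_mod (all_ones_poly p) M"
  have "\<exists>a q. a \<noteq> 0 \<and> smult a (all_ones_poly p) = M * q + r" and r: "r = 0 \<or> degree r < degree M"
    unfolding r_def by (rule pseudo_mod, use M in simp)+
  then obtain a q where a: "a \<noteq> 0" and eq: "smult a (all_ones_poly p) = M * q + r" by blast
  have "r = smult a (all_ones_poly p) - M * q" using eq by simp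
  then have "poly (?h r) z = 0" using M Phi by (simp add: diff smult mult)
  then have "r = 0" using r min[of r] by fastforce
  with eq have eq: "smult a (all_ones_poly p) = M * q" by simp
  \<comment> \<open>Contents are multiplicative and the all-ones polynomial has content 1, so
    \<open>a\<close> is, up to the sign \<open>s\<close>, the product of the contents of
    \<open>M\<close> and \<open>q\<close> and can be cancelled.\<close>
  define c where "c = content M"
  have "normalize a = content (smult a (all_ones_poly p :: int poly))"
    using content_all_ones_poly[OF p] by simp
  also have "\<dots> = c * content q" by (simp add: eq content_mult c_def)
  finally have ac: "normalize a = c * content q" .
  obtain M' where M': "M = smult c M'" unfolding c_def using content_times_primitive_part by metis
  obtain q' where q': "q = smult (content q) q'" using content_times_primitive_part by metis
  have "smult a (all_ones_poly p) = smult (c * content q) (M' * q')"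
    using eq by (subst (asm) M', subst (asm) q') (simp add: mult.commute)
  then have "smult a (all_ones_poly p) = smult (normalize a) (M' * q')" by (simp only: ac)
  moreover obtain s where "normalize a = a * s" "s = 1 \<or> s = -1"
    using that[of 1] that[of "-1"] by (cases "a < 0") auto
  ultimately have "smult a (all_ones_poly p) = smult a (smult s M' * q')" by simp
  then have "all_ones_poly p = smult s M' * q'" using a by (simp add: smult_cancel)
  from all_ones_poly_factor[OF assms(1,2) this]
  have "degree M' = 0 \<or> degree q' = 0" using \<open>s = 1 \<or> s = -1\<close> by auto
  moreover have "degree M' \<noteq> 0"
  proof
    assume "degree M' = 0"
    then have "degree M = 0" using M' by simp
    then obtain b where "M = [:b:]" by (rule degree_eq_zeroE)
    with M show False by (simp add: map_poly_pCons)
  qed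
  ultimately have "degree q = 0" using q' by (metis degree_smult_eq)
  moreover have "q \<noteq> 0" using eq a all_ones_poly_nonzero[OF p, where 'a = int] by auto
  ultimately have "degree M = degree (M * q)" using M by (simp add: degree_mult_eq)
  also have "\<dots> = p - 1"
    unfolding eq[symmetric] using a by (simp add: degree_all_ones_poly)
  finally have "degree M = p - 1" .
  then show ?thesis using min[of A] assms by simp
qed

text \<open>Subtracting \<open>a (p - 1)\<close> times the relation that all powers of
  \<open>z\<close> sum to 0 removes the top coefficient. What remains has degree below
  \<open>p - 1\<close> and vanishes at \<open>z\<close>, so it is zero.\<close>

lemma root_of_unity_relation:
  fixes a :: "nat \<Rightarrow> int" and z :: complex
  assumes "CHAR('a::field) = p" "prime p" "z ^ p = 1" "z \<noteq> 1"
    and sum0: "(\<Sum>t<p. of_int (a t) * z ^ t) = 0" and t: "t < p"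
  shows "a t = a (p - 1)"
proof -
  have p: "p > 0" using assms(2) prime_gt_0_nat by blast
  define A where "A = (\<Sum>t<p. monom (a t - a (p - 1)) t)"
  have co: "coeff A t = (if t < p then a t - a (p - 1) else 0)" for t
    by (simp add: A_def coeff_sum)
  have deg: "degree A < p - 1" if "A \<noteq> 0"
  proof -
    have "degree A \<le> p - 1" by (rule degree_le) (auto simp: co)
    moreover have "degree A \<noteq> p - 1"
      using co[of "p - 1"] that p by (metis cancel_comm_monoid_add_class.diff_cancel leading_coeff_0_iff)
    ultimately show ?thesis by simp
  qed
  have "poly (map_poly of_int A) z = (\<Sum>t<p. of_int (a t - a (p - 1)) * z ^ t)"
  proof -
    have "map_poly of_int A = (\<Sum>t<p. monom (of_int (a t - a (p - 1)) :: complex) t)"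
      by (intro poly_eqI) (simp add: coeff_map_poly co coeff_sum)
    then show ?thesis by (simp add: poly_sum poly_monom)
  qed
  also have "\<dots> = (\<Sum>t<p. of_int (a t) * z ^ t) - of_int (a (p - 1)) * (\<Sum>t<p. z ^ t)"
    by (simp add: left_diff_distrib sum_subtractf sum_distrib_left)
  also have "(\<Sum>t<p. z ^ t) = 0"
    using assms(3,4) power_diff_1_eq[of z p] by simp
  finally have "poly (map_poly of_int A) z = 0" using sum0 by simp
  then have "A = 0"
    using root_of_unity_degree[OF assms(1-4), of A] deg by fastforce
  then show ?thesis using co[of t] t by simp
qed

section \<open>Trace and prime subfield of a finite field\<close>

text \<open>The parameter \<open>ty\<close> binds the type variable \<open>'a\<close>, which does
  not occur in the types of \<open>p\<close> and \<open>e\<close>.\<close>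

locale prime_power_field =
  fixes p e :: nat and ty :: "'a::{field,finite} itself"
  assumes prime_p: "prime p" and e_pos: "e > 0"
    and card_UNIV: "card (UNIV :: 'a set) = p ^ e"
begin

lemma p_pos: "p > 0"
  using prime_p prime_gt_0_nat by blast

text \<open>Adding 1 permutes the field; comparing the sums of all elements gives
  \<open>p ^ e = 0\<close> in the field, hence \<open>p = 0\<close>.\<close>

lemma char_p: "CHAR('a) = p"
proof -
  have "(\<Sum>x\<in>UNIV. x + 1 :: 'a) = (\<Sum>x\<in>UNIV. x)"
    by (rule sum.reindex_bij_witness[of _ "\<lambda>x. x - 1" "\<lambda>x. x + 1"]) auto
  then have "of_nat (p ^ e) = (0::'a)"
    by (simp add: sum.distrib card_UNIV)
  then have "of_nat p = (0::'a)" by simp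
  then have "CHAR('a) dvd p" by (simp add: of_nat_eq_0_iff_char_dvd)
  then show ?thesis
    using prime_p CHAR_not_1 by (metis One_nat_def prime_nat_iff)
qed

lemma frobenius_add: "(x + y) ^ p = x ^ p + (y ^ p :: 'a)"
  using freshmans_dream[where 'a = 'a] char_p prime_p by metis

lemma inj_on_of_nat: "inj_on (of_nat :: nat \<Rightarrow> 'a) {..<p}"
  by (auto simp: inj_on_def of_nat_eq_iff_cong_CHAR char_p cong_def)

lemma Fp_conv_image: "Fp p = (of_nat :: nat \<Rightarrow> 'a) ` {..<p}"
  by (auto simp: Fp_def)

lemma card_Fp: "card (Fp p :: 'a set) = p"
  by (simp add: Fp_conv_image card_image inj_on_of_nat)

lemma of_nat_power_p: "(of_nat k :: 'a) ^ p = of_nat k"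
  using p_pos by (induction k) (simp_all add: frobenius_add)

text \<open>The polynomial X^p - X has at most \<open>p\<close> roots, and the \<open>p\<close>
  elements of \<open>Fp p\<close> are roots. Closure under the field operations becomes a
  computation with powers.\<close>

lemma Fp_iff: "(x :: 'a) \<in> Fp p \<longleftrightarrow> x ^ p = x"
proof -
  let ?P = "monom 1 p - [:0, 1:] :: 'a poly"
  have p1: "p > 1" using prime_p prime_gt_1_nat by blast
  have "coeff ?P p = 1" using p1 by (simp add: coeff_pCons split: nat.split)
  then have ne: "?P \<noteq> 0" by (metis coeff_0 zero_neq_one)
  have deg: "degree ?P \<le> p"
    using p1 by (intro degree_diff_le) (auto simp: degree_monom_eq)
  have roots: "{x. poly ?P x = 0} = {x. x ^ p = x}"
    by (auto simp: poly_monom)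
  have "card {x::'a. x ^ p = x} \<le> p"
    using card_poly_roots_bound[OF ne] deg roots by simp
  moreover have "Fp p \<subseteq> {x::'a. x ^ p = x}"
    by (auto simp: Fp_def of_nat_power_p)
  ultimately have "Fp p = {x::'a. x ^ p = x}"
    by (intro card_seteq) (auto simp: card_Fp)
  then show ?thesis by auto
qed

lemma Fp_0 [simp]: "(0::'a) \<in> Fp p" and Fp_1 [simp]: "(1::'a) \<in> Fp p"
  using p_pos by (simp_all add: Fp_iff)

lemma Fp_of_nat [simp]: "(of_nat k :: 'a) \<in> Fp p"
  by (simp add: Fp_iff of_nat_power_p)

lemma Fp_add [simp]: "x \<in> Fp p \<Longrightarrow> y \<in> Fp p \<Longrightarrow> x + y \<in> (Fp p :: 'a set)"
  by (simp add: Fp_iff frobenius_add)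

lemma Fp_mult [simp]: "x \<in> Fp p \<Longrightarrow> y \<in> Fp p \<Longrightarrow> x * y \<in> (Fp p :: 'a set)"
  by (simp add: Fp_iff power_mult_distrib)

lemma Fp_minus [simp]: "x \<in> Fp p \<Longrightarrow> - x \<in> (Fp p :: 'a set)"
proof -
  have "(-1 :: 'a) = of_nat (p - 1)"
    using p_pos char_p by (simp flip: of_nat_CHAR[where 'a = 'a])
  then have "(-1::'a) \<in> Fp p" by simp
  then show "x \<in> Fp p \<Longrightarrow> - x \<in> (Fp p :: 'a set)" using Fp_mult[of "-1" x] by simp
qed

lemma Fp_diff [simp]: "x \<in> Fp p \<Longrightarrow> y \<in> Fp p \<Longrightarrow> x - y \<in> (Fp p :: 'a set)"
  using Fp_add[of x "- y"] by simp

lemma Fp_divide [simp]: "x \<in> Fp p \<Longrightarrow> y \<in> Fp p \<Longrightarrow> x / y \<in> (Fp p :: 'a set)"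
  by (simp add: Fp_iff power_divide)

lemma Fp_sum [simp]: "(\<And>i. i \<in> I \<Longrightarrow> g i \<in> Fp p) \<Longrightarrow> sum g I \<in> (Fp p :: 'a set)"
  by (induction I rule: infinite_finite_induct) auto

lemma fp_val:
  assumes "(y::'a) \<in> Fp p"
  shows "fp_val p y < p" "of_nat (fp_val p y) = y"
proof -
  obtain k where k: "k < p" "of_nat k = y" using assms by (auto simp: Fp_def)
  have "\<exists>!k. k < p \<and> of_nat k = y"
    using k inj_on_of_nat by (auto simp: inj_on_def)
  from theI'[OF this] show "fp_val p y < p" "of_nat (fp_val p y) = y"
    by (auto simp: fp_val_def)
qed

lemma fp_val_of_nat: "k < p \<Longrightarrow> fp_val p (of_nat k :: 'a) = k"
  using fp_val[of "of_nat k :: 'a"] inj_on_of_nat by (auto simp: inj_on_def)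

text \<open>Multiplication by a nonzero \<open>x\<close> permutes the nonzero elements; compare
  their products.\<close>

lemma power_card: "(x::'a) ^ (p ^ e) = x"
proof (cases "x = 0")
  case True
  then show ?thesis using p_pos by simp
next
  case False
  have "(\<Prod>y\<in>UNIV - {0}. x * y) = (\<Prod>y\<in>UNIV - {0}. y)"
    by (rule prod.reindex_bij_witness[of _ "\<lambda>y. y / x" "\<lambda>y. x * y"]) (use False in auto)
  then have "x ^ card (UNIV - {0::'a}) * (\<Prod>y\<in>UNIV - {0}. y) = (\<Prod>y\<in>UNIV - {0}. y)"
    by (simp add: prod.distrib)
  moreover have "(\<Prod>y\<in>UNIV - {0::'a}. y) \<noteq> 0" by simp
  ultimately have "x ^ (p ^ e - 1) = 1" by (simp add: card_Diff_singleton card_UNIV)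
  then have "x * x ^ (p ^ e - 1) = x" by simp
  then show ?thesis using p_pos by (metis Suc_pred' power_Suc zero_less_power)
qed

section \<open>The trace form\<close>

lemma tr_add: "tr p e (x + y) = tr p e x + tr p e (y::'a)"
proof -
  have "(x + y) ^ (p ^ i) = x ^ (p ^ i) + y ^ (p ^ i)" for i
    by (induction i) (simp_all add: power_mult frobenius_add mult.commute[of p])
  then show ?thesis by (simp add: tr_def sum.distrib)
qed

lemma tr_scale: "c \<in> Fp p \<Longrightarrow> tr p e (c * x) = c * tr p e (x::'a)"
proof -
  assume c: "c \<in> Fp p"
  have "c ^ (p ^ i) = c" for i
    using c by (induction i) (simp_all add: power_mult Fp_iff)
  then show ?thesis by (simp add: tr_def power_mult_distrib sum_distrib_left)
qed

lemma tr_0 [simp]: "tr p e (0::'a) = 0"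
  using tr_scale[of 0 0] by simp

lemma tr_minus: "tr p e (- x) = - tr p e (x::'a)"
  using tr_scale[of "-1" x] by simp

lemma tr_diff: "tr p e (x - y) = tr p e x - tr p e (y::'a)"
  using tr_add[of x "- y"] by (simp add: tr_minus)

lemma tr_sum: "tr p e (\<Sum>i\<in>I. g i) = (\<Sum>i\<in>I. tr p e (g i :: 'a))"
  by (induction I rule: infinite_finite_induct) (simp_all add: tr_add)

text \<open>The Frobenius map permutes the summands of the trace cyclically, because
  \<open>x ^ (p ^ e) = x\<close>.\<close>

lemma tr_in_Fp [simp]: "tr p e (x::'a) \<in> Fp p"
proof -
  have pow_sum: "(\<Sum>i\<in>I. g i) ^ p = (\<Sum>i\<in>I. g i ^ p :: 'a)" for I :: "nat set" and g
    using p_pos by (induction I rule: infinite_finite_induct) (simp_all add: frobenius_add)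
  have "tr p e x ^ p = (\<Sum>i<e. x ^ (p ^ Suc i))"
    by (simp add: tr_def pow_sum power_mult[symmetric] mult.commute)
  also have "\<dots> = (\<Sum>i<Suc e. x ^ (p ^ i)) - x"
    by (subst sum.lessThan_Suc_shift) simp
  also have "\<dots> = tr p e x" by (simp add: tr_def power_card)
  finally show ?thesis by (simp add: Fp_iff)
qed

text \<open>The trace is a polynomial function of degree at most \<open>p ^ (e - 1)\<close> with
  linear coefficient 1, so it cannot vanish at all \<open>p ^ e\<close> elements.\<close>

lemma tr_nonzero: "\<exists>x::'a. tr p e x \<noteq> 0"
proof (rule ccontr)
  assume "\<not> ?thesis"
  then have z: "tr p e x = 0" for x :: 'a by blast
  have p1: "p > 1" using prime_p prime_gt_1_nat by blast
  let ?P = "\<Sum>i<e. monom 1 (p ^ i) :: 'a poly"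
  have "coeff ?P 1 = (\<Sum>i<e. if i = 0 then 1 else 0)"
    unfolding coeff_sum using p1 by (intro sum.cong) auto
  then have "coeff ?P 1 = 1" using e_pos by simp
  then have ne: "?P \<noteq> 0" by auto
  have "degree ?P \<le> p ^ (e - 1)"
    using p1 by (intro degree_sum_le) (auto intro!: order_trans[OF degree_monom_le] power_increasing)
  moreover have "poly ?P x = tr p e x" for x by (simp add: poly_sum poly_monom tr_def)
  then have "card {x. poly ?P x = 0} = p ^ e" using z by (simp add: card_UNIV)
  ultimately have "p ^ e \<le> p ^ (e - 1)" using card_poly_roots_bound[OF ne] by simp
  then show False using p1 e_pos by simp
qed

lemma tr_nondegenerate:
  assumes "\<And>x::'a. tr p e (b * x) = 0"
  shows "b = 0"
proof (rule ccontr)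
  assume "b \<noteq> 0"
  then have "tr p e x = 0" for x :: 'a using assms[of "x / b"] by simp
  then show False using tr_nonzero by blast
qed

text \<open>All \<open>p\<close> fibres are translates of each other and partition the
  field.\<close>

lemma card_tr_fibre:
  assumes b: "(b::'a) \<noteq> 0" and t: "t \<in> Fp p"
  shows "card {x. tr p e (b * x) = t} = p ^ (e - 1)"
proof -
  obtain y where y: "tr p e (b * y) \<noteq> 0" using tr_nondegenerate b by blast
  \<comment> \<open>By linearity over \<open>Fp p\<close>, rescaling \<open>y\<close> gives a point
    \<open>w s\<close> in the fibre over \<open>s\<close>.\<close>
  define w where "w s = s / tr p e (b * y) * y" for s
  have w: "tr p e (b * w s) = s" if "s \<in> Fp p" for s
    using tr_scale[of "s / tr p e (b * y)" "b * y"] that y by (simp add: w_def mult_ac)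
  have eq: "card {x. tr p e (b * x) = s} = card {x. tr p e (b * x) = t}" if s: "s \<in> Fp p" for s
    by (rule bij_betw_same_card[of "\<lambda>x. x - w s + w t"],
        rule bij_betw_byWitness[of _ "\<lambda>x. x - w t + w s"])
       (use s t w in \<open>auto simp: distrib_left right_diff_distrib tr_add tr_diff\<close>)
  have "p ^ e = (\<Sum>s\<in>Fp p. card {x. tr p e (b * x) = s})"
    using card_UNIV sum.group[of "UNIV :: 'a set" "Fp p" "\<lambda>x. tr p e (b * x)" "\<lambda>_. 1::nat"] by (simp add: image_subset_iff)
  also have "\<dots> = p * card {x. tr p e (b * x) = t}" using eq by (simp add: card_Fp)
  finally show ?thesis using e_pos p_pos
    by (metis Suc_pred' mult_cancel1 not_gr_zero power_Suc)
qed

text \<open>A relation with top index \<open>m < e\<close> makes the span \<open>S\<close> of the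
  first \<open>m\<close> powers closed under multiplication by \<open>\<beta>\<close>. It contains
  1, hence all powers, hence the whole field, although it has at most \<open>p ^ m\<close>
  elements.\<close>

lemma power_basis_inj:
  assumes \<beta>: "\<beta> \<noteq> 0" "\<And>x::'a. x \<noteq> 0 \<Longrightarrow> \<exists>i::nat. \<beta> ^ i = x"
    and v: "\<And>i. i < e \<Longrightarrow> v i \<in> Fp p" "(\<Sum>i<e. v i * \<beta> ^ i) = 0" "i < e"
  shows "v i = 0"
proof (rule ccontr)
  assume "v i \<noteq> 0"
  define m where "m = Max {j. j < e \<and> v j \<noteq> 0}"
  have "finite {j. j < e \<and> v j \<noteq> 0}" "{j. j < e \<and> v j \<noteq> 0} \<noteq> {}"
    using v(3) \<open>v i \<noteq> 0\<close> by auto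
  then have "m \<in> {j. j < e \<and> v j \<noteq> 0}" and max: "\<And>j. j \<in> {j. j < e \<and> v j \<noteq> 0} \<Longrightarrow> j \<le> m"
    unfolding m_def using Max_in Max_ge by blast+
  then have m: "m < e" "v m \<noteq> 0" and gt: "\<And>j. j < e \<Longrightarrow> j > m \<Longrightarrow> v j = 0"
    by (auto simp: not_le[symmetric])
  define S where "S = {\<Sum>j<m. c j * \<beta> ^ j | c. c \<in> {..<m} \<rightarrow>\<^sub>E Fp p}"
  have S_I: "(\<Sum>j<m. c j * \<beta> ^ j) \<in> S" if "\<And>j. j < m \<Longrightarrow> c j \<in> Fp p" for c
    unfolding S_def using that
    by (intro CollectI exI[of _ "restrict c {..<m}"] conjI) auto
  have "0 = (\<Sum>j<Suc m. v j * \<beta> ^ j)"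
    unfolding v(2)[symmetric] using m gt by (intro sum.mono_neutral_right) auto
  then have "v m * \<beta> ^ m = - (\<Sum>j<m. v j * \<beta> ^ j)"
    by (simp add: add_eq_0_iff)
  then have \<beta>m: "\<beta> ^ m = (\<Sum>j<m. (- v j / v m) * \<beta> ^ j)"
    using m(2) by (simp add: sum_divide_distrib[symmetric] sum_negf field_simps)
  have closed: "\<beta> * x \<in> S" if "x \<in> S" for x
  proof -
    obtain c where c: "c \<in> {..<m} \<rightarrow>\<^sub>E Fp p" "x = (\<Sum>j<m. c j * \<beta> ^ j)"
      using \<open>x \<in> S\<close> by (auto simp: S_def)
    show ?thesis
    proof (cases m)
      case 0
      then show ?thesis using c S_I[of c] by simp
    next
      case (Suc k)
      \<comment> \<open>Multiplication by \<open>\<beta>\<close> shifts the coefficients; the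
        overflow at index \<open>m\<close> is rewritten with the relation for
        \<open>\<beta> ^ m\<close>.\<close>
      define c' where "c' j = (if j = 0 then 0 else c (j - 1))" for j
      have "\<beta> * x = (\<Sum>j<m. c j * \<beta> ^ Suc j)" by (simp add: c sum_distrib_left mult_ac)
      also have "\<dots> = (\<Sum>j<Suc m. c' j * \<beta> ^ j)"
        by (subst sum.lessThan_Suc_shift) (simp add: c'_def)
      also have "\<dots> = (\<Sum>j<m. c' j * \<beta> ^ j) + c' m * (\<Sum>j<m. (- v j / v m) * \<beta> ^ j)"
        by (simp add: \<beta>m)
      also have "\<dots> = (\<Sum>j<m. (c' j + c' m * (- v j / v m)) * \<beta> ^ j)"
        by (simp only: sum_distrib_left distrib_right sum.distrib mult.assoc)
      also have "\<dots> \<in> S"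
      proof (rule S_I)
        fix j assume "j < m"
        moreover have "c' j \<in> Fp p" if "j \<le> m" for j
          using c(1) that Suc by (auto simp: c'_def PiE_def Pi_def)
        ultimately show "c' j + c' m * (- v j / v m) \<in> Fp p"
          using v(1)[of j] v(1)[of m] m(1) by (intro Fp_add Fp_mult Fp_divide Fp_minus) auto
      qed
      finally show ?thesis .
    qed
  qed
  have "m \<noteq> 0" using \<beta>m by (metis lessThan_0 power_0 sum.empty zero_neq_one)
  then have "(\<Sum>j<m. (if j = 0 then 1 else 0) * \<beta> ^ j) = 1"
    by (simp add: if_distrib[of "\<lambda>x. x * _"] cong: if_cong)
  then have "1 \<in> S" using S_I[of "\<lambda>j. if j = 0 then 1 else 0"] by auto
  then have pow: "\<beta> ^ i \<in> S" for i by (induction i) (auto intro: closed)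
  moreover have "0 \<in> S" using S_I[of "\<lambda>_. 0"] by simp
  ultimately have "S = UNIV" using \<beta> by (metis UNIV_eq_I)
  moreover have "card S \<le> p ^ m"
  proof -
    have "S = (\<lambda>c. \<Sum>j<m. c j * \<beta> ^ j) ` ({..<m} \<rightarrow>\<^sub>E Fp p)" by (auto simp: S_def)
    then have "card S \<le> card ({..<m} \<rightarrow>\<^sub>E (Fp p :: 'a set))"
      by (simp add: card_image_le finite_PiE)
    then show ?thesis by (simp add: card_PiE card_Fp)
  qed
  ultimately have "p ^ e \<le> p ^ m" by (simp add: card_UNIV)
  moreover have "p > 1" using prime_p prime_gt_1_nat by blast
  ultimately show False using m(1) by simp
qed

text \<open>By independence the coefficient vectors have \<open>p ^ e\<close> distinct images, which
  exhaust the field.\<close>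

lemma power_basis_surj:
  assumes \<beta>: "\<beta> \<noteq> 0" "\<And>x::'a. x \<noteq> 0 \<Longrightarrow> \<exists>i::nat. \<beta> ^ i = x"
  obtains c where "\<And>i. i < e \<Longrightarrow> c i \<in> Fp p" "x = (\<Sum>i<e. c i * \<beta> ^ i)"
proof -
  let ?g = "\<lambda>c. \<Sum>j<e. c j * \<beta> ^ j"
  let ?A = "{..<e} \<rightarrow>\<^sub>E (Fp p :: 'a set)"
  have "inj_on ?g ?A"
  proof (rule inj_onI)
    fix c c' assume c: "c \<in> ?A" "c' \<in> ?A" and eq: "?g c = ?g c'"
    have "c i - c' i = 0" if "i < e" for i
    proof (rule power_basis_inj[OF \<beta>, of "\<lambda>i. c i - c' i"])
      show "c j - c' j \<in> Fp p" if "j < e" for j using c that by (auto simp: PiE_def Pi_def)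
      show "(\<Sum>i<e. (c i - c' i) * \<beta> ^ i) = 0"
        using eq by (simp add: left_diff_distrib sum_subtractf)
    qed (use that in auto)
    then show "c = c'" using c by (intro PiE_ext[of c _ _ c']) auto
  qed
  then have "card (?g ` ?A) = card (UNIV :: 'a set)"
    by (simp add: card_image card_PiE card_Fp card_UNIV)
  then have "?g ` ?A = UNIV" by (intro card_subset_eq) auto
  then obtain c where "c \<in> ?A" "x = ?g c" by blast
  then show ?thesis by (intro that[of c]) auto
qed

text \<open>It suffices to test the trace form on a basis. For the dual code this means that the
  trace rows of \<open>G2\<close> determine the point of a column.\<close>

lemma tr_power_basis_nondegenerate:
  assumes \<beta>: "\<beta> \<noteq> 0" "\<And>x::'a. x \<noteq> 0 \<Longrightarrow> \<exists>i::nat. \<beta> ^ i = x"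
    and z: "\<And>i. i < e \<Longrightarrow> tr p e (\<beta> ^ i * x) = 0"
  shows "x = 0"
proof (rule tr_nondegenerate)
  fix y :: 'a
  obtain c where c: "\<And>i. i < e \<Longrightarrow> c i \<in> Fp p" "y = (\<Sum>i<e. c i * \<beta> ^ i)"
    using power_basis_surj[OF \<beta>] by blast
  have "x * y = (\<Sum>i<e. c i * (\<beta> ^ i * x))"
    unfolding c(2) sum_distrib_left by (intro sum.cong) (simp_all add: mult_ac)
  then have "tr p e (x * y) = (\<Sum>i<e. tr p e (c i * (\<beta> ^ i * x)))" by (simp add: tr_sum)
  also have "\<dots> = 0" using c(1) z by (intro sum.neutral) (auto simp: tr_scale)
  finally show "tr p e (x * y) = 0" .
qed

end

section \<open>Fibres of weakly regular bent functions\<close>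

lemma Legendre_cong:
  assumes "[a = b] (mod p)"
  shows "Legendre a p = Legendre b p"
proof -
  have "[a = 0] (mod p) \<longleftrightarrow> [b = 0] (mod p)" using assms cong_sym cong_trans by blast
  moreover have "QuadRes p a \<longleftrightarrow> QuadRes p b"
    unfolding QuadRes_def using assms cong_sym cong_trans by blast
  ultimately show ?thesis by (simp add: Legendre_def)
qed

text \<open>A nonzero residue with a root \<open>y\<close> has the two roots \<open>y\<close> and
  \<open>p - y\<close>, distinct because \<open>p\<close> is odd; 0 has only the root 0.\<close>

lemma card_sqrt_mod:
  assumes "prime p" "odd p" "t \<in> {0..<int p}"
  shows "int (card {j \<in> {0..<int p}. j\<^sup>2 mod int p = t}) = 1 + Legendre t (int p)"
proof -
  have p: "int p > 0" using assms prime_gt_0_nat by simp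
  have pp: "prime (int p)" using assms by simp
  have t0: "[t = 0] (mod int p) \<longleftrightarrow> t = 0"
    using assms(3) by (auto simp: cong_def)
  have ct: "j\<^sup>2 mod int p = t \<longleftrightarrow> [j\<^sup>2 = t] (mod int p)" for j
    using assms(3) by (auto simp: cong_def)
  show ?thesis
  proof (cases "t = 0")
    case True
    have "{j \<in> {0..<int p}. j\<^sup>2 mod int p = t} = {0}"
    proof (intro equalityI subsetI)
      fix j assume j: "j \<in> {j \<in> {0..<int p}. j\<^sup>2 mod int p = t}"
      then have "int p dvd j" using True prime_dvd_power[OF pp, of j 2] by auto
      then show "j \<in> {0}" using j by (auto dest: zdvd_imp_le)
    qed (use p True in auto)
    then show ?thesis using True by (simp add: Legendre_def)
  next
    case False
    show ?thesis
    proof (cases "QuadRes (int p) t")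
      case qr: True
      then obtain y0 where y0: "[y0\<^sup>2 = t] (mod int p)" by (auto simp: QuadRes_def)
      define y where "y = y0 mod int p"
      have y: "y \<in> {0..<int p}" "[y\<^sup>2 = t] (mod int p)"
        using p y0 by (auto simp: y_def cong_def power_mod)
      have "y \<noteq> 0" using y(2) t0 False by (metis cong_sym zero_power2)
      have ne: "y \<noteq> int p - y" using assms(2) by presburger
      have "{j \<in> {0..<int p}. j\<^sup>2 mod int p = t} = {y, int p - y}"
      proof (intro equalityI subsetI)
        fix j assume j: "j \<in> {j \<in> {0..<int p}. j\<^sup>2 mod int p = t}"
        then have "[j\<^sup>2 = y\<^sup>2] (mod int p)" using y(2) ct cong_sym cong_trans by blast
        then have "int p dvd (j - y) * (j + y)"
          by (simp add: cong_iff_dvd_diff power2_eq_square algebra_simps)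
        then have "int p dvd j - y \<or> int p dvd j + y" using pp prime_dvd_mult_iff by blast
        then show "j \<in> {y, int p - y}"
        proof
          assume "int p dvd j - y"
          then have "j mod int p = y mod int p" by (simp add: mod_eq_dvd_iff)
          then show ?thesis using j y by simp
        next
          assume "int p dvd j + y"
          then have "int p dvd (j + y) - int p" by (intro dvd_diff) auto
          then have "int p dvd j - (int p - y)" by (simp add: algebra_simps)
          then have "j mod int p = (int p - y) mod int p" by (simp only: mod_eq_dvd_iff)
          moreover have "int p - y \<in> {0..<int p}" using y(1) \<open>y \<noteq> 0\<close> by auto
          ultimately have "j = int p - y" using j by (metis (no_types, lifting) atLeastLessThan_iff mem_Collect_eq mod_pos_pos_trivial)
          then show ?thesis by simp
        qed
      next
        fix j assume "j \<in> {y, int p - y}"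
        moreover have "[(int p - y)\<^sup>2 = y\<^sup>2] (mod int p)"
        proof -
          have "(int p - y)\<^sup>2 - y\<^sup>2 = int p * (int p - 2 * y)"
            by (simp add: power2_eq_square algebra_simps)
          then show ?thesis unfolding cong_iff_dvd_diff by simp
        qed
        then have "[(int p - y)\<^sup>2 = t] (mod int p)" using y(2) cong_trans by blast
        ultimately show "j \<in> {j \<in> {0..<int p}. j\<^sup>2 mod int p = t}"
          using y \<open>y \<noteq> 0\<close> ct by auto
      qed
      then show ?thesis using ne False qr t0 by (simp add: Legendre_def)
    next
      case nqr: False
      then have "{j \<in> {0..<int p}. j\<^sup>2 mod int p = t} = {}"
        using ct by (auto simp: QuadRes_def)
      then show ?thesis using False nqr t0 by (simp only: Legendre_def) simp
    qed
  qed
qed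

text \<open>Group the indices by their squares. Constant \<open>g\<close> yields
  \<open>sum_Legendre\<close>, the additive character yields the Gauss sum.\<close>

lemma sum_squares_mod:
  fixes g :: "int \<Rightarrow> 'b::comm_ring_1"
  assumes "prime p" "odd p"
  shows "(\<Sum>j\<in>{0..<int p}. g (j\<^sup>2 mod int p)) = (\<Sum>t\<in>{0..<int p}. of_int (1 + Legendre t (int p)) * g t)"
proof -
  let ?I = "{0..<int p}"
  have p: "int p > 0" using assms prime_gt_0_nat by simp
  have "(\<Sum>j\<in>?I. g (j\<^sup>2 mod int p)) = (\<Sum>t\<in>?I. \<Sum>j\<in>{j\<in>?I. j\<^sup>2 mod int p = t}. g (j\<^sup>2 mod int p))"
    using p by (intro sum.group[symmetric]) auto
  also have "\<dots> = (\<Sum>t\<in>?I. of_int (int (card {j\<in>?I. j\<^sup>2 mod int p = t})) * g t)"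
    by (intro sum.cong refl) simp
  also have "\<dots> = (\<Sum>t\<in>?I. of_int (1 + Legendre t (int p)) * g t)"
    using card_sqrt_mod[OF assms] by (intro sum.cong refl) simp
  finally show ?thesis .
qed

lemma sum_Legendre:
  assumes "prime p" "odd p"
  shows "(\<Sum>t\<in>{0..<int p}. Legendre t (int p)) = 0"
  using sum_squares_mod[OF assms, of "\<lambda>_. 1 :: int"] by (simp add: sum.distrib)

text \<open>The weight \<open>1 + Legendre t p\<close> splits the quadratic sum; the part with
  weight 1 vanishes by orthogonality.\<close>

theorem gauss_sum_Legendre:
  assumes "prime p" "odd p"
  shows "(\<Sum>t\<in>{0..<int p}. of_int (Legendre t (int p)) * e_mod p t) = sqrt_pstar p"
proof -
  have p: "p > 0" "p \<noteq> 1" using assms prime_gt_0_nat not_prime_1 by blast+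
  have "sqrt_pstar p = (\<Sum>j\<in>{0..<int p}. e_mod p (j\<^sup>2 mod int p))"
    unfolding quad_sum_eq[OF assms, symmetric] quad_sum_def
    using p by (intro sum.cong refl e_mod_cong) simp_all
  also have "\<dots> = (\<Sum>t\<in>{0..<int p}. of_int (Legendre t (int p)) * e_mod p t) + (\<Sum>t\<in>{0..<int p}. e_mod p (1 * t))"
    unfolding sum_squares_mod[OF assms] by (simp add: distrib_right sum.distrib)
  also have "(\<Sum>t\<in>{0..<int p}. e_mod p (1 * t)) = 0"
    unfolding sum_e_mod[OF p(1)] using p by simp
  finally show ?thesis by simp
qed

text \<open>Euler's criterion gives the value modulo \<open>p\<close>; since \<open>p > 2\<close>,
  the signs 1 and -1 are not congruent.\<close>

lemma eta0_neg1_eq: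
  assumes "prime p" "odd p"
  shows "eta0_neg1 p = (if p mod 4 = 1 then 1 else -1)"
proof -
  have p: "p > 2" using assms prime_ge_2_nat by (metis le_neq_implies_less even_numeral)
  have "\<not> [-1 = 0] (mod int p)" using p by (simp add: cong_iff_dvd_diff)
  then have L: "eta0_neg1 p = 1 \<or> eta0_neg1 p = -1"
    by (auto simp: eta0_neg1_def Legendre_def)
  have "[eta0_neg1 p = (-1) ^ ((p - 1) div 2)] (mod int p)"
    unfolding eta0_neg1_def by (rule euler_criterion) fact+
  also have "(-1::int) ^ ((p - 1) div 2) = (if p mod 4 = 1 then 1 else -1)"
  proof -
    have "even ((p - 1) div 2) \<longleftrightarrow> p mod 4 = 1" using assms(2) p by presburger
    then show ?thesis by (auto simp: uminus_power_if)
  qed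
  finally have "int p dvd eta0_neg1 p - (if p mod 4 = 1 then 1 else -1)"
    by (simp only: cong_iff_dvd_diff)
  moreover have "\<not> int p dvd 2" "\<not> int p dvd - 2" using p by (auto dest: zdvd_imp_le)
  ultimately show ?thesis using L by (auto split: if_splits)
qed

lemma sqrt_pstar_square:
  assumes "prime p" "odd p"
  shows "(sqrt_pstar p)\<^sup>2 = of_int (eta0_neg1 p * int p)"
  unfolding eta0_neg1_eq[OF assms] sqrt_pstar_def
  by (simp add: power_mult_distrib flip: of_real_power)

text \<open>An involution without fixed points splits the set into pairs; remove one pair at a
  time.\<close>

lemma even_card_involution:
  assumes "finite A" "\<And>x. x \<in> A \<Longrightarrow> h x \<in> A \<and> h (h x) = x \<and> h x \<noteq> x"
  shows "even (card A)"
  using assms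
proof (induction A rule: finite_psubset_induct)
  case (psubset A)
  show ?case
  proof (cases "A = {}")
    case False
    then obtain x where x: "x \<in> A" by blast
    have "even (card (A - {x, h x}))"
    proof (rule psubset.IH)
      show "A - {x, h x} \<subset> A" using x by blast
      show "h y \<in> A - {x, h x} \<and> h (h y) = y \<and> h y \<noteq> y" if "y \<in> A - {x, h x}" for y
        using psubset.prems[of y] psubset.prems[of x] x that by auto
    qed
    moreover have "card (A - {x, h x}) = card A - card {x, h x}" "card A \<ge> card {x, h x}"
      using psubset.prems[OF x] x psubset.hyps
      by (auto simp del: card_insert_disjoint intro!: card_mono card_Diff_subset)
    moreover have "card {x, h x} = 2" using psubset.prems[OF x] by (auto simp: card_insert_if)
    ultimately show ?thesis by simp
  qed simp
qed

section \<open>From the Walsh transform to fibre sizes\<close>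

context prime_power_field
begin

lemma zeta_pow_eq: "zeta_pow p y = e_mod p (int (fp_val p (y::'a)))"
  by (simp add: zeta_pow_def e_mod_def)

text \<open>Two integer combinations of the powers of \<open>e_mod p 1\<close> agree, so their
  coefficients differ by a constant. Summing over all \<open>k\<close> identifies it: the fibres add
  up to \<open>p ^ e\<close> and the Legendre symbols to 0.\<close>

theorem bent_fibre_card:
  fixes f :: "'a \<Rightarrow> 'a" and s :: 'a
  assumes odd: "odd p" "odd e"
    and f: "\<And>x. f x \<in> Fp p" and s: "s \<in> Fp p"
    and W: "walsh p e f b = of_int \<epsilon> * sqrt_pstar p ^ e * zeta_pow p s"
    and t: "t \<in> Fp p"
  shows "int (card {x. f x - tr p e (b * x) = t}) = int p ^ (e - 1) +
    \<epsilon> * (eta0_neg1 p * int p) ^ ((e - 1) div 2) * Legendre (int (fp_val p t) - int (fp_val p s)) (int p)"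
proof -
  define g where "g x = f x - tr p e (b * x)" for x
  define n where "n k = int (card {x. fp_val p (g x) = k})" for k
  define Q where "Q = \<epsilon> * (eta0_neg1 p * int p) ^ ((e - 1) div 2)"
  define L where "L k = Legendre (int k - int (fp_val p s)) (int p)" for k
  have g: "g x \<in> Fp p" for x using f by (simp add: g_def)
  have z: "e_mod p 1 ^ p = 1" "e_mod p 1 \<noteq> 1"
    using p_pos prime_p by (auto simp: e_mod_power e_mod_eq_1_iff)
  have zk: "e_mod p (int k) = e_mod p 1 ^ k" for k by (simp add: e_mod_power)
  have lhs: "walsh p e f b = (\<Sum>k<p. of_int (n k) * e_mod p 1 ^ k)"
  proof -
    have "walsh p e f b = (\<Sum>x\<in>UNIV. e_mod p 1 ^ fp_val p (g x))"
      by (simp add: walsh_def zeta_pow_eq zk g_def)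
    also have "\<dots> = (\<Sum>k<p. \<Sum>x\<in>{x\<in>UNIV. fp_val p (g x) = k}. e_mod p 1 ^ fp_val p (g x))"
      using fp_val(1)[OF g] by (intro sum.group[symmetric]) auto
    also have "\<dots> = (\<Sum>k<p. of_int (n k) * e_mod p 1 ^ k)"
      by (intro sum.cong refl) (simp add: n_def)
    finally show ?thesis .
  qed
  \<comment> \<open>For odd \<open>e\<close> all factors but one pair up into an integer; the
    remaining one is the Gauss sum.\<close>
  have "sqrt_pstar p ^ e = sqrt_pstar p ^ (2 * ((e - 1) div 2) + 1)"
    using odd(2) by (intro arg_cong[of _ _ "power _"]) presburger
  then have pw: "of_int \<epsilon> * sqrt_pstar p ^ e = of_int Q * sqrt_pstar p"
    using sqrt_pstar_square[OF prime_p odd(1)] by (simp add: Q_def power_mult)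
  have "sqrt_pstar p * zeta_pow p s =
     (\<Sum>t\<in>{0..<int p}. of_int (Legendre t (int p)) * e_mod p (t + int (fp_val p s)))"
    unfolding gauss_sum_Legendre[OF prime_p odd(1), symmetric] zeta_pow_eq
    by (simp add: sum_distrib_right e_mod_add mult.assoc)
  \<comment> \<open>Written in the shifted index, so that periodicity can undo the shift.\<close>
  also have "\<dots> = (\<Sum>t\<in>{0..<int p}. of_int (Legendre (t + int (fp_val p s) - int (fp_val p s)) (int p))
      * e_mod p (t + int (fp_val p s)))" by simp
  also have "\<dots> = (\<Sum>t\<in>{0..<int p}. of_int (Legendre (t - int (fp_val p s)) (int p)) * e_mod p t)"
  proof (rule sum_mod_shift)
    fix a b assume "[a = b] (mod int p)"
    then show "of_int (Legendre (a - int (fp_val p s)) (int p)) * e_mod p a =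
        of_int (Legendre (b - int (fp_val p s)) (int p)) * e_mod p b"
      using p_pos Legendre_cong[OF cong_diff[OF _ cong_refl]] e_mod_cong by metis
  qed (use p_pos in simp)
  also have "\<dots> = (\<Sum>k<p. of_int (L k) * e_mod p 1 ^ k)"
    unfolding sum_int_atLeastLessThan by (simp add: L_def zk)
  finally have "walsh p e f b = of_int Q * (\<Sum>k<p. of_int (L k) * e_mod p 1 ^ k)"
    using W pw by (metis mult.assoc)
  then have "(\<Sum>k<p. of_int (n k - Q * L k) * e_mod p 1 ^ k) = 0"
    unfolding lhs by (simp add: left_diff_distrib sum_subtractf sum_distrib_left mult.assoc)
  from root_of_unity_relation[OF char_p prime_p z this]
  have const: "n k - Q * L k = n (p - 1) - Q * L (p - 1)" if "k < p" for k using that .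
  have "(\<Sum>k<p. L k) = (\<Sum>t\<in>{0..<int p}. Legendre (t + - int (fp_val p s)) (int p))"
    by (simp add: L_def sum_int_atLeastLessThan)
  also have "\<dots> = (\<Sum>t\<in>{0..<int p}. Legendre t (int p))"
    using p_pos by (intro sum_mod_shift Legendre_cong) auto
  also have "\<dots> = 0" using sum_Legendre prime_p odd by blast
  finally have sumL: "(\<Sum>k<p. L k) = 0" .
  have "int p ^ e = int (card (UNIV::'a set))" by (simp add: card_UNIV)
  also have "\<dots> = (\<Sum>k<p. n k)"
    using sum.group[of "UNIV::'a set" "{..<p}" "\<lambda>x. fp_val p (g x)" "\<lambda>_. 1::int"] fp_val(1)[OF g]
    by (simp add: n_def image_subset_iff)
  also have "\<dots> = (\<Sum>k<p. n k - Q * L k)"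
    by (simp add: sum_subtractf sum_distrib_left[symmetric] sumL)
  also have "\<dots> = (\<Sum>k<p. n (p - 1) - Q * L (p - 1))"
    by (intro sum.cong refl const) simp
  also have "\<dots> = int p * (n (p - 1) - Q * L (p - 1))"
    by simp
  also have "int p ^ e = int p * int p ^ (e - 1)"
    using e_pos by (simp flip: power_Suc)
  finally have c: "int p ^ (e - 1) = n (p - 1) - Q * L (p - 1)" using p_pos by simp
  have "fp_val p (g x) = fp_val p t \<longleftrightarrow> g x = t" for x
    using fp_val(2)[OF g] fp_val(2)[OF t] by metis
  then have "int (card {x. g x = t}) = n (fp_val p t)" by (simp add: n_def)
  also have "\<dots> = int p ^ (e - 1) + Q * L (fp_val p t)"
    using const[of "fp_val p t"] fp_val(1)[OF t] c by simp
  finally show ?thesis by (simp add: g_def Q_def L_def)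
qed

text \<open>The zero set of \<open>f\<close> is closed under negation, so it has odd cardinality, and this forces the
  Legendre symbol in the fibre formula to vanish.\<close>

lemma bent_dual_at_0:
  fixes f :: "'a \<Rightarrow> 'a" and s :: 'a
  assumes odd: "odd p" "odd e"
    and f: "\<And>x. f x \<in> Fp p" "f 0 = 0" "\<And>x. f (- x) = f x" and s: "s \<in> Fp p"
    and \<epsilon>: "\<epsilon> = 1 \<or> \<epsilon> = -1"
    and W: "walsh p e f 0 = of_int \<epsilon> * sqrt_pstar p ^ e * zeta_pow p s"
  shows "s = 0"
proof -
  have two: "(2::'a) \<noteq> 0"
  proof
    assume "(2::'a) = 0"
    then have "of_nat 2 = (0::'a)" by simp
    then have "p dvd 2" by (simp add: of_nat_eq_0_iff_char_dvd char_p del: of_nat_numeral)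
    then show False using odd(1) prime_p by (metis primes_dvd_imp_eq two_is_prime_nat)
  qed
  have "even (card ({x. f x = 0} - {0}))"
  proof (rule even_card_involution[of _ uminus])
    fix x assume "x \<in> {x. f x = 0} - {0}"
    moreover have "- x \<noteq> x" if "x \<noteq> 0"
    proof
      assume "- x = x"
      then have "2 * x = 0" by (metis add.right_inverse mult_2)
      then show False using that two by simp
    qed
    ultimately show "- x \<in> {x. f x = 0} - {0} \<and> - (- x) = x \<and> - x \<noteq> x" using f(3) by auto
  qed simp
  moreover have "card {x. f x = 0} = Suc (card ({x. f x = 0} - {0}))"
    using f(2) by (intro card.remove) auto
  ultimately have "odd (int (card {x. f x = 0}))" by simp
  also have "int (card {x. f x = 0}) = int p ^ (e - 1) + \<epsilon> * (eta0_neg1 p * int p) ^ ((e - 1) div 2) *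
      Legendre (int (fp_val p (0::'a)) - int (fp_val p s)) (int p)"
    using bent_fibre_card[OF odd f(1) s W, of 0] by simp
  \<comment> \<open>Both \<open>p ^ (e - 1)\<close> and the factor in front of the symbol are odd,
    so the symbol is even and hence 0.\<close>
  finally have "even (Legendre (int (fp_val p (0::'a)) - int (fp_val p s)) (int p))"
    using odd(1) \<epsilon> eta0_neg1_eq[OF prime_p odd(1)] by (auto split: if_splits)
  then have "int p dvd int (fp_val p (0::'a)) - int (fp_val p s)"
    by (auto simp: Legendre_def cong_iff_dvd_diff split: if_splits)
  moreover have "fp_val p (0::'a) = 0" using fp_val_of_nat[of 0] p_pos by simp
  ultimately have "p dvd fp_val p s" by simp
  then have "fp_val p s = 0" using fp_val(1)[OF s] by (auto dest: dvd_imp_le)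
  then show ?thesis using fp_val(2)[OF s] by simp
qed

end

section \<open>Systematic codes\<close>

lemma min_dist_eqI:
  assumes "finite C" "c \<in> C" "c \<noteq> (\<lambda>_. 0)" "weight n c \<le> d"
    and "\<And>c. c \<in> C \<Longrightarrow> c \<noteq> (\<lambda>_. 0) \<Longrightarrow> d \<le> weight n c"
  shows "min_dist n C = d"
  unfolding min_dist_def
proof (rule Min_eqI)
  show "finite {weight n c | c. c \<in> C \<and> c \<noteq> (\<lambda>_. 0)}"
    using assms(1) by simp
  have "weight n c = d" using assms by (simp add: le_antisym)
  then show "d \<in> {weight n c | c. c \<in> C \<and> c \<noteq> (\<lambda>_. 0)}" using assms by blast
qed (use assms in auto)

text \<open>This is the matrix \<open>[I_k : A]\<close>. Facts for arbitrary \<open>A\<close> are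
  kept apart from the bent function.\<close>

definition systematic :: "nat \<Rightarrow> (nat \<Rightarrow> nat \<Rightarrow> 'a) \<Rightarrow> nat \<Rightarrow> nat \<Rightarrow> 'a::{zero,one}" where
  "systematic k A i j = (if j < k then (if i = j then 1 else 0) else A i (j - k))"

lemma G2'_eq_systematic: "G2' p e f \<beta> d = systematic (e + 2) (G2 p e f \<beta> d)"
  by (intro ext) (simp add: G2'_def systematic_def)

definition sys_word :: "nat \<Rightarrow> nat \<Rightarrow> (nat \<Rightarrow> nat \<Rightarrow> 'a) \<Rightarrow> (nat \<Rightarrow> 'a) \<Rightarrow> nat \<Rightarrow> 'a::field" where
  "sys_word k n A u j =
    (if j < k then u j else if j < k + n then (\<Sum>i<k. u i * A i (j - k)) else 0)"

lemma gen_code_systematic: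
  "gen_code p k (k + n) (systematic k A) = {sys_word k n A u | u. \<forall>i. u i \<in> Fp p}"
proof -
  have "(if j < k + n then (\<Sum>i<k. u i * systematic k A i j) else 0) = sys_word k n A u j" for u j
  proof (cases "j < k")
    case True
    have "(\<Sum>i<k. u i * systematic k A i j) = (\<Sum>i<k. if i = j then u i else 0)"
      using True by (intro sum.cong) (auto simp: systematic_def)
    then show ?thesis using True by (simp add: sys_word_def)
  qed (auto simp: sys_word_def systematic_def)
  then show ?thesis unfolding gen_code_def by auto
qed

lemma bij_betw_split_coordinates:
  "bij_betw (\<lambda>j. j + k) {j. j < n \<and> P (j + k)} {j::nat. k \<le> j \<and> j < k + n \<and> P j}"
  by (rule bij_betw_byWitness[of _ "\<lambda>j. j - k"]) auto

lemma weight_split: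
  "weight (k + n) c = card {i. i < k \<and> c i \<noteq> 0} + card {j. j < n \<and> c (k + j) \<noteq> 0}"
proof -
  have "{j. j < k + n \<and> c j \<noteq> 0} = {i. i < k \<and> c i \<noteq> 0} \<union> {j. k \<le> j \<and> j < k + n \<and> c j \<noteq> 0}"
    by auto
  moreover have "card ({i. i < k \<and> c i \<noteq> 0} \<union> {j. k \<le> j \<and> j < k + n \<and> c j \<noteq> 0}) =
      card {i. i < k \<and> c i \<noteq> 0} + card {j. k \<le> j \<and> j < k + n \<and> c j \<noteq> 0}"
    by (rule card_Un_disjoint) auto
  moreover have "card {j. k \<le> j \<and> j < k + n \<and> c j \<noteq> 0} = card {j. j < n \<and> c (k + j) \<noteq> 0}"
    using bij_betw_same_card[OF bij_betw_split_coordinates[of k n "\<lambda>j. c j \<noteq> 0"]]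
    by (simp add: add.commute)
  ultimately show ?thesis by (simp add: weight_def)
qed

section \<open>Size and dual of a systematic code\<close>

context prime_power_field
begin

lemma finite_words: "finite (words p n :: (nat \<Rightarrow> 'a) set)"
  and card_words: "card (words p n :: (nat \<Rightarrow> 'a) set) = p ^ n"
proof -
  have bij: "bij_betw (\<lambda>c. restrict c {..<n}) (words p n :: (nat \<Rightarrow> 'a) set) ({..<n} \<rightarrow>\<^sub>E Fp p)"
    by (rule bij_betw_byWitness[of _ "\<lambda>c j. if j < n then c j else 0"])
       (auto simp: words_def fun_eq_iff PiE_def extensional_def Pi_def)
  show "card (words p n :: (nat \<Rightarrow> 'a) set) = p ^ n"
    using bij_betw_same_card[OF bij] by (simp add: card_PiE card_Fp)
  show "finite (words p n :: (nat \<Rightarrow> 'a) set)"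
    using bij_betw_finite[OF bij] by (simp add: finite_PiE)
qed

context
  fixes k n :: nat and A :: "nat \<Rightarrow> nat \<Rightarrow> 'a"
  assumes A: "\<And>i j. A i j \<in> Fp p"
begin

lemma sys_word_in_words: "(\<And>i. i < k \<Longrightarrow> u i \<in> Fp p) \<Longrightarrow> sys_word k n A u \<in> words p (k + n)"
  using A by (auto simp: sys_word_def words_def intro!: Fp_sum Fp_mult)

lemma systematic_code_subset: "gen_code p k (k + n) (systematic k A) \<subseteq> words p (k + n)"
  unfolding gen_code_systematic using sys_word_in_words by auto

lemma card_systematic_code: "card (gen_code p k (k + n) (systematic k A)) = p ^ k"
proof -
  have "bij_betw (sys_word k n A) (words p k) (gen_code p k (k + n) (systematic k A))"
    unfolding gen_code_systematic
  \<comment> \<open>Messages in \<open>gen_code\<close> are arbitrary from index \<open>k\<close>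
    on; restricting them to \<open>words p k\<close> makes encoding injective, and the message is
    read off the first \<open>k\<close> coordinates.\<close>
  proof (rule bij_betw_byWitness[of _ "\<lambda>c j. if j < k then c j else 0"])
    show "\<forall>u\<in>words p k. (\<lambda>j. if j < k then sys_word k n A u j else 0) = u"
      by (auto simp: words_def sys_word_def fun_eq_iff)
    have "sys_word k n A (\<lambda>j. if j < k then sys_word k n A u j else 0) = sys_word k n A u" for u
      by (auto simp: sys_word_def fun_eq_iff)
    then show "\<forall>c\<in>{sys_word k n A u | u. \<forall>i. u i \<in> Fp p}.
        sys_word k n A (\<lambda>j. if j < k then c j else 0) = c" by auto
  qed (auto simp: words_def sys_word_def)
  from bij_betw_same_card[OF this] show ?thesis by (simp add: card_words)
qed

lemma systematic_code_add:
  assumes "x \<in> gen_code p k (k + n) (systematic k A)" "y \<in> gen_code p k (k + n) (systematic k A)"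
  shows "(\<lambda>j. x j + y j) \<in> gen_code p k (k + n) (systematic k A)"
proof -
  obtain u v where u: "\<forall>i. u i \<in> Fp p" "x = sys_word k n A u"
    and v: "\<forall>i. v i \<in> Fp p" "y = sys_word k n A v"
    using assms by (auto simp: gen_code_systematic)
  have "(\<lambda>j. x j + y j) = sys_word k n A (\<lambda>i. u i + v i)"
    by (auto simp: u v sys_word_def fun_eq_iff distrib_right sum.distrib)
  then show ?thesis using u v by (auto simp: gen_code_systematic)
qed

text \<open>Orthogonality need only be tested on the unit messages, that is, on the rows of the
  matrix. So the last \<open>n\<close> coordinates are free and determine the first
  \<open>k\<close>.\<close>

lemma dual_systematic_iff:
  "v \<in> dual_code p (k + n) (gen_code p k (k + n) (systematic k A)) \<longleftrightarrow>
    v \<in> words p (k + n) \<and> (\<forall>i<k. v i = - (\<Sum>l<n. A i l * v (k + l)))"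
proof -
  have split: "(\<Sum>j<k + n. v j * sys_word k n A u j) =
      (\<Sum>i<k. u i * (v i + (\<Sum>l<n. A i l * v (k + l))))" for u
  proof -
    have "(\<Sum>j<k + n. v j * sys_word k n A u j) = (\<Sum>j<k. v j * u j) + (\<Sum>j\<in>{k..<k + n}. v j * sys_word k n A u j)"
      by (subst sum.atLeastLessThan_concat[of 0 k "k + n", symmetric, unfolded atLeast0LessThan])
         (auto simp: sys_word_def)
    also have "(\<Sum>j\<in>{k..<k + n}. v j * sys_word k n A u j) = (\<Sum>l<n. v (k + l) * (\<Sum>i<k. u i * A i l))"
      using sum.shift_bounds_nat_ivl[of "\<lambda>j. v j * sys_word k n A u j" 0 k n]
      by (simp add: add.commute[of _ k] atLeast0LessThan sys_word_def)
    also have "\<dots> = (\<Sum>i<k. \<Sum>l<n. u i * (A i l * v (k + l)))"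
      by (subst sum.swap) (simp add: sum_distrib_left mult_ac)
    finally show ?thesis by (simp add: distrib_left sum.distrib sum_distrib_left mult_ac)
  qed
  have "(\<forall>c\<in>gen_code p k (k + n) (systematic k A). (\<Sum>j<k + n. v j * c j) = 0) \<longleftrightarrow>
      (\<forall>i<k. v i + (\<Sum>l<n. A i l * v (k + l)) = 0)"
  proof
    assume *: "\<forall>c\<in>gen_code p k (k + n) (systematic k A). (\<Sum>j<k + n. v j * c j) = 0"
    show "\<forall>i<k. v i + (\<Sum>l<n. A i l * v (k + l)) = 0"
    proof (intro allI impI)
      fix i assume i: "i < k"
      define u where "u j = (if j = i then 1 else 0 :: 'a)" for j
      have "sys_word k n A u \<in> gen_code p k (k + n) (systematic k A)"
        unfolding gen_code_systematic by (auto simp: u_def)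
      then have "(\<Sum>j<k. u j * (v j + (\<Sum>l<n. A j l * v (k + l)))) = 0" using * split by metis
      moreover have "(\<Sum>j<k. u j * (v j + (\<Sum>l<n. A j l * v (k + l)))) =
          (\<Sum>j<k. if j = i then v j + (\<Sum>l<n. A j l * v (k + l)) else 0)"
        by (intro sum.cong) (auto simp: u_def)
      ultimately show "v i + (\<Sum>l<n. A i l * v (k + l)) = 0" using i by simp
    qed
  next
    assume "\<forall>i<k. v i + (\<Sum>l<n. A i l * v (k + l)) = 0"
    then show "\<forall>c\<in>gen_code p k (k + n) (systematic k A). (\<Sum>j<k + n. v j * c j) = 0"
      by (auto simp: gen_code_systematic split)
  qed
  then show ?thesis by (auto simp: dual_code_def add_eq_0_iff2)
qed

lemma card_dual_systematic:
  "card (dual_code p (k + n) (gen_code p k (k + n) (systematic k A))) = p ^ n"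
proof -
  define h where "h w j = (if j < k then - (\<Sum>l<n. A j l * w l) else if j < k + n then w (j - k) else 0)"
    for w :: "nat \<Rightarrow> 'a" and j
  have h: "h w \<in> dual_code p (k + n) (gen_code p k (k + n) (systematic k A))" if "w \<in> words p n" for w
    unfolding dual_systematic_iff using A that
    by (auto simp: words_def h_def intro!: Fp_sum Fp_mult Fp_minus)
  have "bij_betw h (words p n) (dual_code p (k + n) (gen_code p k (k + n) (systematic k A)))"
  proof (rule bij_betw_byWitness[of _ "\<lambda>v j. if j < n then v (k + j) else 0"])
    show "\<forall>w\<in>words p n. (\<lambda>j. if j < n then h w (k + j) else 0) = w"
      by (auto simp: h_def words_def fun_eq_iff)
    show "\<forall>v\<in>dual_code p (k + n) (gen_code p k (k + n) (systematic k A)).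
        h (\<lambda>j. if j < n then v (k + j) else 0) = v"
      by (auto simp: dual_systematic_iff h_def words_def fun_eq_iff)
    show "h ` words p n \<subseteq> dual_code p (k + n) (gen_code p k (k + n) (systematic k A))"
      using h by blast
    show "(\<lambda>v j. if j < n then v (k + j) else 0) ` dual_code p (k + n) (gen_code p k (k + n) (systematic k A)) \<subseteq> words p n"
      by (auto simp: dual_systematic_iff words_def)
  qed
  from bij_betw_same_card[OF this] show ?thesis by (simp add: card_words)
qed

end

lemma dual_code_subset: "dual_code p n C \<subseteq> words p n"
  by (auto simp: dual_code_def)

lemma dual_code_add:
  fixes x y :: "nat \<Rightarrow> 'a"
  assumes "x \<in> dual_code p n C" "y \<in> dual_code p n C"
  shows "(\<lambda>j. x j + y j) \<in> dual_code p n C"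
  using assms by (auto simp: dual_code_def words_def distrib_right sum.distrib)

end

text \<open>Distance 5 means balls of radius 2, and their outermost layer alone suffices: as
  \<open>n\<close> exceeds the dimension by \<open>e + 2\<close>, it has to have more than
  \<open>p ^ (e + 2)\<close> words.\<close>

lemma sphere_packing_bound_check:
  assumes "p \<ge> 3" "e \<ge> 3"
  shows "sp_almost_optimal p (p ^ e + e + 2) (p ^ e) 3"
proof -
  define n where "n = p ^ e + e + 2"
  have q: "p ^ 3 \<le> p ^ e" using assms by (intro power_increasing) auto
  have "27 \<le> p ^ 3" using power_mono[of 3 p 3] assms by simp
  have "3 * (p - 1) \<ge> 2 * p" using assms by simp
  then have "(2 * p) * (2 * p) \<le> (3 * (p - 1)) * (3 * (p - 1))" using mult_le_mono by blast
  then have A: "4 * p\<^sup>2 \<le> 9 * (p - 1)\<^sup>2" by (simp add: power2_eq_square)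
  have "p ^ e * (n - 1) \<le> n * (n - 1)" unfolding n_def by (intro mult_mono) auto
  also have "\<dots> = 2 * (n choose 2)"
  proof -
    have "even (n * (n - 1))" by (cases n) auto
    then show ?thesis by (simp add: choose_two)
  qed
  finally have B: "p ^ e * (n - 1) \<le> 2 * (n choose 2)" .
  have "n - 1 > 27" using q \<open>27 \<le> p ^ 3\<close> assms unfolding n_def by linarith
  then have "p ^ e * 27 < p ^ e * (n - 1)" using assms by simp
  with B have C: "p ^ e * 27 < 2 * (n choose 2)" by linarith
  \<comment> \<open>The factor 18 is 2 times 9, the denominators cleared in \<open>B\<close> and
    \<open>A\<close>; it is smaller than 27 times 4.\<close>
  have "18 * p ^ (e + 2) < p ^ e * 27 * (4 * p\<^sup>2)"
    using assms by (simp add: power_add power2_eq_square)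
  also have "\<dots> \<le> (2 * (n choose 2)) * (9 * (p - 1)\<^sup>2)"
    by (rule mult_le_mono[OF less_imp_le[OF C] A])
  also have "\<dots> = 18 * ((n choose 2) * (p - 1)\<^sup>2)" by simp
  finally have D: "p ^ (e + 2) < (n choose 2) * (p - 1)\<^sup>2" by simp
  have "p ^ n = p ^ p ^ e * p ^ (e + 2)" by (simp add: n_def power_add[symmetric] add.assoc)
  also have "\<dots> < p ^ p ^ e * ((n choose 2) * (p - 1)\<^sup>2)" using D assms by simp
  also have "\<dots> \<le> p ^ p ^ e * (\<Sum>i\<le>2. (n choose i) * (p - 1) ^ i)"
    by (intro mult_le_mono le_refl member_le_sum) auto
  finally show ?thesis unfolding n_def sp_almost_optimal_def sphere_packing_excludes_def
    by simp
qed

section \<open>The code of a bent function\<close>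

text \<open>The condition \<open>f_minus\<close> is homogeneity for the scalar -1, where the even
  exponent disappears.\<close>

locale bent_code = prime_power_field p e ty
  for p e :: nat and ty :: "'a::{field,finite} itself" +
  fixes f fstar :: "'a \<Rightarrow> 'a" and \<epsilon> :: int and \<beta> :: 'a and d :: "nat \<Rightarrow> 'a"
  assumes odd_p: "odd p" and odd_e: "odd e"
    and f_Fp: "\<And>x. f x \<in> Fp p" and f_0: "f 0 = 0" and f_minus: "\<And>x. f (- x) = f x"
    and \<epsilon>: "\<epsilon> = 1 \<or> \<epsilon> = -1"
    and fstar_Fp: "\<And>b. fstar b \<in> Fp p"
    and walsh: "\<And>b. walsh p e f b = of_int \<epsilon> * sqrt_pstar p ^ e * zeta_pow p (fstar b)"
    and \<beta>: "\<beta> \<noteq> 0" "\<And>x::'a. x \<noteq> 0 \<Longrightarrow> \<exists>i::nat. \<beta> ^ i = x"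
    and d: "bij_betw d {0..<p ^ e} UNIV" "d (p ^ e - 1) = 0"
begin

abbreviation code :: "(nat \<Rightarrow> 'a) set" where
  "code \<equiv> gen_code p (e + 2) ((e + 2) + p ^ e) (systematic (e + 2) (G2 p e f \<beta> d))"

definition tail_coeff :: "(nat \<Rightarrow> 'a) \<Rightarrow> 'a" where
  "tail_coeff u = (\<Sum>i<e. u (i + 2) * \<beta> ^ i)"

definition eval_form :: "(nat \<Rightarrow> 'a) \<Rightarrow> 'a \<Rightarrow> 'a" where
  "eval_form u x = u 0 + u 1 * (f x + 1) + tr p e (tail_coeff u * x)"

lemma G2_Fp: "G2 p e f \<beta> d i j \<in> Fp p"
  using f_Fp by (simp add: G2_def)

lemma sum_shift_2: "(\<Sum>i<e + 2. g i) = g 0 + g 1 + (\<Sum>i<e. g (i + 2) :: 'a)"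
  by (simp add: sum.lessThan_Suc_shift numeral_2_eq_2 add.assoc del: sum.lessThan_Suc)

lemma sum_G2:
  assumes "\<And>i. u i \<in> Fp p"
  shows "(\<Sum>i<e + 2. u i * G2 p e f \<beta> d i j) = eval_form u (d j)"
proof -
  have "(\<Sum>i<e. u (i + 2) * tr p e (\<beta> ^ i * d j)) = tr p e (tail_coeff u * d j)"
    using assms by (simp add: tail_coeff_def sum_distrib_right tr_sum tr_scale mult.assoc)
  then show ?thesis unfolding sum_shift_2 by (simp add: G2_def eval_form_def)
qed

text \<open>As \<open>d\<close> enumerates the whole field, the tail weight is the number of
  elements outside the zero set. Integers avoid truncated subtraction.\<close>

lemma weight_code_word:
  assumes "\<And>i. u i \<in> Fp p"
  shows "int (weight ((e + 2) + p ^ e) (sys_word (e + 2) (p ^ e) (G2 p e f \<beta> d) u)) =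
    int (card {i. i < e + 2 \<and> u i \<noteq> 0}) + int p ^ e - int (card {x. eval_form u x = 0})"
proof -
  let ?c = "sys_word (e + 2) (p ^ e) (G2 p e f \<beta> d) u"
  have "{i. i < e + 2 \<and> ?c i \<noteq> 0} = {i. i < e + 2 \<and> u i \<noteq> 0}"
    by (auto simp: sys_word_def)
  moreover have "card {j. j < p ^ e \<and> ?c (e + 2 + j) \<noteq> 0} = card {x. eval_form u x \<noteq> 0}"
  proof -
    have "{j. j < p ^ e \<and> ?c (e + 2 + j) \<noteq> 0} = {j. j < p ^ e \<and> eval_form u (d j) \<noteq> 0}"
      using sum_G2[of u, OF assms] by (auto simp: sys_word_def simp del: sum.lessThan_Suc)
    then have "card {j. j < p ^ e \<and> ?c (e + 2 + j) \<noteq> 0} =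
        card {j. j < p ^ e \<and> eval_form u (d j) \<noteq> 0}" by (simp only:)
    also have "\<dots> = card (d ` {j. j < p ^ e \<and> eval_form u (d j) \<noteq> 0})"
      using d(1) by (intro card_image[symmetric]) (auto simp: bij_betw_def inj_on_def)
    also have "d ` {j. j < p ^ e \<and> eval_form u (d j) \<noteq> 0} = {x. eval_form u x \<noteq> 0}"
      using d(1) unfolding bij_betw_def by (force simp: image_iff set_eq_iff)
    finally show ?thesis .
  qed
  moreover have "card {x. eval_form u x \<noteq> 0} + card {x. eval_form u x = 0} = p ^ e"
    unfolding card_UNIV[symmetric] by (subst card_Un_disjoint[symmetric]) (auto intro: arg_cong[of _ _ card])
  then have "int (card {x. eval_form u x \<noteq> 0}) = int p ^ e - int (card {x. eval_form u x = 0})"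
    by (metis add_diff_cancel_right' of_nat_add of_nat_power)
  ultimately show ?thesis unfolding weight_split by simp
qed

lemmas code_subset = systematic_code_subset[where k = "e + 2" and n = "p ^ e" and A = "G2 p e f \<beta> d", OF G2_Fp]
  and code_add = systematic_code_add[where k = "e + 2" and n = "p ^ e" and A = "G2 p e f \<beta> d", OF G2_Fp]
  and card_code = card_systematic_code[where k = "e + 2" and n = "p ^ e" and A = "G2 p e f \<beta> d", OF G2_Fp]
  and dual_iff = dual_systematic_iff[where k = "e + 2" and n = "p ^ e" and A = "G2 p e f \<beta> d", OF G2_Fp]
  and card_dual = card_dual_systematic[where k = "e + 2" and n = "p ^ e" and A = "G2 p e f \<beta> d", OF G2_Fp]

text \<open>The sign that separates the two cases of the theorem.\<close>

definition sgn_code :: int where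
  "sgn_code = \<epsilon> * eta0_neg1 p ^ ((e + 1) div 2)"

lemma sgn_code: "sgn_code = 1 \<or> sgn_code = -1"
  using \<epsilon> eta0_neg1_eq[OF prime_p odd_p] by (auto simp: sgn_code_def uminus_power_if)

lemma eta_square: "eta0_neg1 p * eta0_neg1 p = 1"
  using eta0_neg1_eq[OF prime_p odd_p] by simp

lemma fstar_0: "fstar 0 = 0"
  using bent_dual_at_0[OF odd_p odd_e f_Fp f_0 f_minus fstar_Fp \<epsilon> walsh] .

text \<open>The square of \<open>eta0_neg1 p\<close> is 1, so one factor can be moved next to the
  Legendre symbol, where it cancels the symbol of -1 in \<open>zeros_eq\<close>.\<close>

lemma fibre_card:
  assumes "t \<in> Fp p"
  shows "int (card {x. f x - tr p e (b * x) = t}) = int p ^ (e - 1) +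
    sgn_code * int p ^ ((e - 1) div 2) *
      (eta0_neg1 p * Legendre (int (fp_val p t) - int (fp_val p (fstar b))) (int p))"
proof -
  have "(e + 1) div 2 = Suc ((e - 1) div 2)" using odd_e by presburger
  then have "sgn_code * eta0_neg1 p = \<epsilon> * eta0_neg1 p ^ ((e - 1) div 2) * (eta0_neg1 p * eta0_neg1 p)"
    by (simp add: sgn_code_def mult_ac)
  then have "sgn_code * eta0_neg1 p = \<epsilon> * eta0_neg1 p ^ ((e - 1) div 2)"
    by (simp add: eta_square)
  then have "\<epsilon> * (eta0_neg1 p * int p) ^ ((e - 1) div 2) =
      sgn_code * int p ^ ((e - 1) div 2) * eta0_neg1 p"
    by (simp add: power_mult_distrib mult_ac)
  then show ?thesis
    using bent_fibre_card[OF odd_p odd_e f_Fp fstar_Fp walsh assms, of b] by (simp add: mult.assoc)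
qed

section \<open>Zero counts and the minimum distances of the code and its dual\<close>

lemma eval_form_zeros:
  assumes "\<And>i. u i \<in> Fp p" "u 1 \<noteq> 0"
  shows "{x. eval_form u x = 0} =
    {x. f x - tr p e (- tail_coeff u / u 1 * x) = - (u 0 + u 1) / u 1}"
proof -
  have "tr p e (- tail_coeff u / u 1 * x) = - tr p e (tail_coeff u * x) / u 1" for x
    using tr_scale[of "- 1 / u 1" "tail_coeff u * x"] assms(1) by simp
  then have "f x - tr p e (- tail_coeff u / u 1 * x) - (- (u 0 + u 1) / u 1) = eval_form u x / u 1" for x
    using assms(2) by (simp only: eval_form_def) (simp add: field_simps)
  then have "eval_form u x = 0 \<longleftrightarrow> f x - tr p e (- tail_coeff u / u 1 * x) = - (u 0 + u 1) / u 1" for x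
    using assms(2) by (metis divide_eq_0_iff eq_iff_diff_eq_0)
  then show ?thesis by blast
qed

text \<open>For \<open>u 1 \<noteq> 0\<close> the zero set is a fibre of the bent function,
  otherwise a fibre of a trace form or empty.\<close>

lemma zeros_le:
  assumes u: "\<And>i. u i \<in> Fp p" and "i < e + 2" "u i \<noteq> 0"
  shows "int (card {x. eval_form u x = 0}) \<le> int p ^ (e - 1) + int p ^ ((e - 1) div 2)"
    and "u 1 = 0 \<Longrightarrow> int (card {x. eval_form u x = 0}) \<le> int p ^ (e - 1)"
proof -
  show *: "int (card {x. eval_form u x = 0}) \<le> int p ^ (e - 1)" if u1: "u 1 = 0"
  proof (cases "tail_coeff u = 0")
    case True
    \<comment> \<open>By independence of the power basis only \<open>u 0\<close> is left, so the
      form is a nonzero constant.\<close>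
    have "u (j + 2) = 0" if "j < e" for j
      using power_basis_inj[OF \<beta>, of "\<lambda>i. u (i + 2)" j] u True that by (simp add: tail_coeff_def)
    then have "i = 0"
      using assms(2,3) u1 by (metis One_nat_def add_2_eq_Suc' less_Suc_eq_0_disj not_less_eq)
    then show ?thesis using True u1 assms(3) by (simp add: eval_form_def)
  next
    case False
    have "{x. eval_form u x = 0} = {x. tr p e (tail_coeff u * x) = - u 0}"
      using u1 by (auto simp: eval_form_def add_eq_0_iff)
    then show ?thesis using card_tr_fibre[OF False, of "- u 0"] u by simp
  qed
  show "int (card {x. eval_form u x = 0}) \<le> int p ^ (e - 1) + int p ^ ((e - 1) div 2)"
  proof (cases "u 1 = 0")
    case True
    from *[OF this] show ?thesis by (simp add: add_increasing2)
  next
    case False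
    define l where "l = sgn_code * (eta0_neg1 p * Legendre (int (fp_val p (- (u 0 + u 1) / u 1)) -
        int (fp_val p (fstar (- tail_coeff u / u 1)))) (int p))"
    have "l \<le> 1"
      using sgn_code eta0_neg1_eq[OF prime_p odd_p] by (auto simp: l_def Legendre_def)
    then have "int p ^ ((e - 1) div 2) * l \<le> int p ^ ((e - 1) div 2) * 1"
      by (intro mult_left_mono) auto
    moreover have "int (card {x. eval_form u x = 0}) = int p ^ (e - 1) + int p ^ ((e - 1) div 2) * l"
      unfolding eval_form_zeros[of u, OF u False] using u
      by (subst fibre_card) (simp_all add: l_def mult_ac)
    ultimately show ?thesis by simp
  qed
qed

text \<open>These messages pick multiples of the second row, so the fibre is over -1 with
  \<open>b = 0\<close>. Because \<open>fstar 0 = 0\<close>, its Legendre symbol is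
  \<open>eta0_neg1 p\<close>.\<close>

lemma zeros_eq:
  assumes u: "\<And>i. u i \<in> Fp p" and "u 1 \<noteq> 0" "u 0 = 0" "\<And>i. i < e \<Longrightarrow> u (i + 2) = 0"
  shows "int (card {x. eval_form u x = 0}) = int p ^ (e - 1) + sgn_code * int p ^ ((e - 1) div 2)"
proof -
  have "tail_coeff u = 0" using assms(4) by (simp add: tail_coeff_def)
  then have "{x. eval_form u x = 0} = {x. f x - tr p e (0 * x) = - 1}"
    unfolding eval_form_zeros[of u, OF u assms(2)] using assms(2,3) by simp
  moreover have "fp_val p (0::'a) = 0" using fp_val_of_nat[of 0] p_pos by simp
  moreover have "Legendre (int (fp_val p (-1 :: 'a)) - 0) (int p) = eta0_neg1 p"
  proof -
    have "of_nat (p - 1) = (-1 :: 'a)"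
      using p_pos char_p by (simp flip: of_nat_CHAR[where 'a = 'a])
    then have "fp_val p (-1 :: 'a) = p - 1" using fp_val_of_nat[of "p - 1"] p_pos by simp
    then have "[int (fp_val p (-1 :: 'a)) - 0 = - 1] (mod int p)"
      using p_pos by (simp add: cong_iff_dvd_diff)
    then show ?thesis unfolding eta0_neg1_def by (rule Legendre_cong)
  qed
  ultimately show ?thesis
    using fibre_card[of "-1" 0] by (simp add: fstar_0 eta_square)
qed

text \<open>The symbols sum to 0 and the symbol of 1 is nonzero, so both signs occur.\<close>

lemma exists_Legendre_value:
  assumes "s = 1 \<or> s = -1"
  shows "\<exists>t\<in>{0..<int p}. Legendre t (int p) = s"
proof (rule ccontr)
  assume *: "\<not> ?thesis"
  have p1: "p > 1" using prime_p prime_gt_1_nat by blast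
  have range: "Legendre t (int p) \<in> {-1, 0, 1}" for t by (simp add: Legendre_def)
  have nz: "Legendre 1 (int p) \<noteq> 0"
    using p1 by (simp add: Legendre_def cong_iff_dvd_diff)
  have "0 < (\<Sum>t\<in>{0..<int p}. - s * Legendre t (int p))"
  proof (rule sum_pos2[of _ 1])
    show "0 < - s * Legendre 1 (int p)"
      using * range[of 1] nz assms p1 by auto
    show "0 \<le> - s * Legendre t (int p)" if "t \<in> {0..<int p}" for t
      using * range[of t] assms that by auto
  qed (use p1 in auto)
  then show False using sum_Legendre[OF prime_p odd_p] by (simp add: sum_negf flip: sum_distrib_left)
qed

text \<open>The first two rows suffice for the maximal number of zeros: \<open>u 0\<close> moves the
  fibre to any desired value.\<close>

lemma exists_word_max_zeros:
  "\<exists>u. (\<forall>i. u i \<in> Fp p) \<and> u 1 = 1 \<and> card {i. i < e + 2 \<and> u i \<noteq> 0} \<le> 2 \<and>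
     int (card {x. eval_form u x = 0}) = int p ^ (e - 1) + int p ^ ((e - 1) div 2)"
proof -
  define s where "s = sgn_code * eta0_neg1 p"
  have "s = 1 \<or> s = -1" using sgn_code eta0_neg1_eq[OF prime_p odd_p] by (auto simp: s_def)
  then obtain t where t: "t \<in> {0..<int p}" "Legendre t (int p) = s"
    using exists_Legendre_value by blast
  define t' :: 'a where "t' = of_nat (nat t)"
  \<comment> \<open>With this \<open>u 0\<close> the fibre value \<open>- (u 0 + u 1) / u 1\<close>
    equals \<open>t'\<close>.\<close>
  define u where "u i = (if i = 0 then - 1 - t' else if i = 1 then 1 else 0)" for i :: nat
  have "t' \<in> Fp p" by (simp add: t'_def)
  then have u: "u i \<in> Fp p" for i by (simp add: u_def)
  have "card {i. i < e + 2 \<and> u i \<noteq> 0} \<le> card {0, 1::nat}"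
    by (rule card_mono) (auto simp: u_def)
  then have wt: "card {i. i < e + 2 \<and> u i \<noteq> 0} \<le> 2" by simp
  have "tail_coeff u = 0" by (simp add: tail_coeff_def u_def)
  then have "{x. eval_form u x = 0} = {x. f x - tr p e (0 * x) = t'}"
    using eval_form_zeros[of u, OF u] by (simp add: u_def)
  moreover have "fp_val p (0::'a) = 0" using fp_val_of_nat[of 0] p_pos by simp
  moreover have "int (fp_val p t') = t"
    unfolding t'_def using t(1) by (subst fp_val_of_nat) auto
  moreover have "sgn_code * eta0_neg1 p * s = 1"
    using \<open>s = 1 \<or> s = -1\<close> by (auto simp: s_def)
  then have "sgn_code * (eta0_neg1 p * s) = 1" by (simp add: mult.assoc)
  ultimately have "int (card {x. eval_form u x = 0}) = int p ^ (e - 1) + int p ^ ((e - 1) div 2)"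
    using fibre_card[of t' 0] t(2) \<open>t' \<in> Fp p\<close> by (simp add: fstar_0 mult_ac)
  then show ?thesis using u wt by (intro exI[of _ u]) (simp add: u_def)
qed

lemma sys_word_eq_0_iff:
  "sys_word (e + 2) n A u = (\<lambda>_. 0) \<longleftrightarrow> (\<forall>i<e + 2. u i = (0::'a))"
  by (auto simp: sys_word_def fun_eq_iff)

text \<open>The weight is the message weight plus the non-zeros. A message of weight 1 reaches the
  maximal number of zeros only if \<open>sgn_code = 1\<close>, through the second row; otherwise
  weight 2 is needed.\<close>

lemma code_params:
  assumes k: "k = (if sgn_code = 1 then 1 else 2)"
  shows "has_params p code ((e + 2) + p ^ e) (e + 2) (p ^ e - p ^ (e - 1) - p ^ ((e - 1) div 2) + k)"
proof -
  let ?n = "(e + 2) + p ^ e"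
  let ?w = "sys_word (e + 2) (p ^ e) (G2 p e f \<beta> d)"
  let ?m = "(e - 1) div 2"
  have p2: "p \<ge> 2" using prime_p prime_ge_2_nat by blast
  have "p ^ ?m \<le> p ^ (e - 1)" using p2 by (intro power_increasing) auto
  then have "p ^ (e - 1) + p ^ ?m \<le> 2 * p ^ (e - 1)" by simp
  also have "\<dots> \<le> p * p ^ (e - 1)" using p2 by simp
  also have "\<dots> = p ^ e" using e_pos by (simp flip: power_Suc)
  \<comment> \<open>The preceding estimate shows that the subtractions of naturals are not
    truncated.\<close>
  finally have D: "int (p ^ e - p ^ (e - 1) - p ^ ?m + k) = int p ^ e - int p ^ (e - 1) - int p ^ ?m + int k"
    by simp
  have fin: "finite code"
    using finite_subset[OF code_subset finite_words] .
  obtain u where u: "\<And>i. u i \<in> Fp p" "u 1 = 1"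
    and wu: "int (weight ?n (?w u)) \<le> int p ^ e - int p ^ (e - 1) - int p ^ ?m + int k"
  proof (cases "sgn_code = 1")
    case True
    define u where "u i = (if i = 1 then 1 else 0 :: 'a)" for i :: nat
    have "{i. i < e + 2 \<and> u i \<noteq> 0} = {1}" by (auto simp: u_def)
    moreover have "int (card {x. eval_form u x = 0}) = int p ^ (e - 1) + int p ^ ?m"
      using zeros_eq[of u] True by (simp add: u_def)
    ultimately show ?thesis
      using weight_code_word[of u] True k by (intro that[of u]) (simp_all add: u_def)
  next
    case False
    obtain u where "\<forall>i. u i \<in> Fp p" "u 1 = 1" "card {i. i < e + 2 \<and> u i \<noteq> 0} \<le> 2"
      "int (card {x. eval_form u x = 0}) = int p ^ (e - 1) + int p ^ ?m"
      using exists_word_max_zeros by blast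
    then show ?thesis
      using weight_code_word[of u] False k by (intro that[of u]) simp_all
  qed
  have "min_dist ?n code = p ^ e - p ^ (e - 1) - p ^ ?m + k"
  proof (rule min_dist_eqI[OF fin])
    show "?w u \<in> code" unfolding gen_code_systematic using u by blast
    show "?w u \<noteq> (\<lambda>_. 0)" unfolding sys_word_eq_0_iff using u(2) by (auto intro!: exI[of _ 1])
    show "weight ?n (?w u) \<le> p ^ e - p ^ (e - 1) - p ^ ?m + k" using wu D by linarith
  next
    fix c assume "c \<in> code" "c \<noteq> (\<lambda>_. 0)"
    then obtain v where v: "\<And>i. v i \<in> Fp p" and c: "c = ?w v"
      unfolding gen_code_systematic by blast
    obtain i where i: "i < e + 2" "v i \<noteq> 0"
      using \<open>c \<noteq> (\<lambda>_. 0)\<close> unfolding c sys_word_eq_0_iff by blast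
    let ?S = "{i. i < e + 2 \<and> v i \<noteq> 0}"
    have S: "card ?S > 0" using i by (auto simp: card_gt_0_iff)
    have m1: "int p ^ ?m \<ge> 1" using p_pos by simp
    have "int (card {x. eval_form v x = 0}) + int k \<le> int p ^ (e - 1) + int p ^ ?m + int (card ?S)"
    proof (cases "k = 1 \<or> card ?S \<ge> 2")
      case True
      have "k \<le> 2" using k by simp
      then have "k \<le> card ?S" using True S by auto
      then show ?thesis using zeros_le(1)[of v i, OF v i] by linarith
    next
      case False
      \<comment> \<open>For messages of weight 1 there is now at least one zero fewer than the
        maximum, which makes up for the missing unit of weight.\<close>
      then have k2: "k = 2" "sgn_code = -1" and c1: "card ?S = 1" using k sgn_code S by (auto split: if_splits)
      show ?thesis
      proof (cases "v 1 = 0")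
        case True
        then show ?thesis using zeros_le(2)[of v i, OF v i] m1 k2 c1 by linarith
      next
        case v1: False
        obtain j where "?S = {j}" using c1 card_1_singletonE by blast
        moreover have "1 \<in> ?S" using v1 by simp
        ultimately have S1: "?S = {1}" by auto
        have "v 0 = 0" "\<And>i. i < e \<Longrightarrow> v (i + 2) = 0" using S1 by (auto simp: set_eq_iff)
        from zeros_eq[of v, OF v v1 this] show ?thesis using k2 c1 m1 by simp
      qed
    qed
    then show "p ^ e - p ^ (e - 1) - p ^ ?m + k \<le> weight ?n c"
      using weight_code_word[of v, OF v] D unfolding c by linarith
  qed
  then show ?thesis unfolding has_params_def
    using code_subset code_add card_code
    by blast
qed

text \<open>No two columns of the generator matrix are dependent. The cases are zero, two or one
  nonzero coordinate of \<open>v\<close> in the last block.\<close>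

lemma dual_weight_ge_3:
  assumes v: "v \<in> dual_code p ((e + 2) + p ^ e) code" "v \<noteq> (\<lambda>_. 0)"
  shows "weight ((e + 2) + p ^ e) v \<ge> 3"
proof (rule ccontr)
  let ?k = "e + 2" and ?A = "G2 p e f \<beta> d"
  let ?S = "{j. j < ?k + p ^ e \<and> v j \<noteq> 0}"
  assume "\<not> ?thesis"
  then have card: "card ?S \<le> 2" by (simp add: weight_def)
  have vw: "v \<in> words p (?k + p ^ e)" and vi: "\<And>i. i < ?k \<Longrightarrow> v i = - (\<Sum>l<p ^ e. ?A i l * v (?k + l))"
    using v(1) unfolding dual_iff by blast+
  obtain l0 where l0: "l0 < p ^ e" "v (?k + l0) \<noteq> 0"
  proof (rule ccontr)
    assume "\<not> thesis"
    with that have z: "v (?k + l) = 0" if "l < p ^ e" for l using \<open>l < p ^ e\<close> by blast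
    have "v j = 0" for j
    proof (cases "j < ?k")
      case True
      then show ?thesis using vi[OF True] z by simp
    next
      case False
      then have j: "?k + (j - ?k) = j" by simp
      show ?thesis
      proof (cases "j < ?k + p ^ e")
        case True
        then have "j - ?k < p ^ e" using False by linarith
        from z[OF this] show ?thesis unfolding j .
      next
        case False
        then show ?thesis using vw by (auto simp: words_def)
      qed
    qed
    then show False using v(2) by auto
  qed
  have "?k + l0 \<in> ?S" using l0 by simp
  then have "card (?S - {?k + l0}) \<le> 1" using card by simp
  then have "\<forall>x\<in>?S - {?k + l0}. \<forall>y\<in>?S - {?k + l0}. x = y"
    by (subst (asm) One_nat_def, subst (asm) card_le_Suc0_iff_eq) simp_all
  then obtain a where a: "?S - {?k + l0} \<subseteq> {a}" by blast
  have inj: "l = l'" if "l < p ^ e" "l' < p ^ e" "d l = d l'" for l l'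
    using d(1) that by (auto simp: bij_betw_def inj_on_def)
  show False
  proof (cases "\<exists>l1<p ^ e. l1 \<noteq> l0 \<and> v (?k + l1) \<noteq> 0")
    case True
    then obtain l1 where l1: "l1 < p ^ e" "l1 \<noteq> l0" "v (?k + l1) \<noteq> 0" by blast
    then have "?k + l1 \<in> ?S - {?k + l0}" by simp
    then have S: "v j = 0" if "j < ?k + p ^ e" "j \<noteq> ?k + l0" "j \<noteq> ?k + l1" for j
      using a that by blast
    have sum: "(\<Sum>l<p ^ e. ?A i l * v (?k + l)) = ?A i l0 * v (?k + l0) + ?A i l1 * v (?k + l1)" for i
    proof -
      have "(\<Sum>l<p ^ e. ?A i l * v (?k + l)) = (\<Sum>l\<in>{l0, l1}. ?A i l * v (?k + l))"
      proof (rule sum.mono_neutral_right)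
        show "\<forall>l\<in>{..<p ^ e} - {l0, l1}. ?A i l * v (?k + l) = 0" using S by simp
      qed (use l0 l1 in auto)
      then show ?thesis using l1 by simp
    qed
    have z: "?A i l0 * v (?k + l0) + ?A i l1 * v (?k + l1) = 0" if "i < ?k" for i
    proof -
      have "v i = 0" using that by (intro S) auto
      then show ?thesis using vi[OF that] sum[of i] by simp
    qed
    \<comment> \<open>The all-ones row makes the two coefficients opposite; the trace rows then
      force equal points.\<close>
    have v1: "v (?k + l1) = - v (?k + l0)" using z[of 0] by (simp add: G2_def add_eq_0_iff)
    have "tr p e (\<beta> ^ i * (d l0 - d l1)) = 0" if "i < e" for i
    proof -
      have "(tr p e (\<beta> ^ i * d l0) - tr p e (\<beta> ^ i * d l1)) * v (?k + l0) = 0"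
        using z[of "i + 2"] that v1 by (simp add: G2_def algebra_simps)
      then show ?thesis using l0(2) by (simp add: right_diff_distrib tr_diff)
    qed
    then have "d l0 - d l1 = 0" using tr_power_basis_nondegenerate[OF \<beta>] by blast
    then have "d l0 = d l1" by simp
    then show False using inj[OF l0(1) l1(1)] l1(2) by simp
  next
    case False
    have sum: "(\<Sum>l<p ^ e. ?A i l * v (?k + l)) = ?A i l0 * v (?k + l0)" for i
    proof -
      have "(\<Sum>l<p ^ e. ?A i l * v (?k + l)) = (\<Sum>l\<in>{l0}. ?A i l * v (?k + l))"
        using l0 False by (intro sum.mono_neutral_right) auto
      then show ?thesis by simp
    qed
    \<comment> \<open>The all-ones row puts coordinate 0 into the support, so the column
      \<open>l0\<close> vanishes in every other row.\<close>
    have "v 0 \<noteq> 0" using vi[of 0] sum[of 0] l0 by (simp add: G2_def)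
    then have "0 \<in> ?S - {?k + l0}" by simp
    then have "a = 0" using a by blast
    have z: "?A i l0 = 0" if "i < ?k" "i \<noteq> 0" for i
    proof -
      have "i \<notin> ?S" using a \<open>a = 0\<close> that by fastforce
      then have "v i = 0" using that by simp
      then show ?thesis using vi[OF that(1)] sum[of i] l0(2) by simp
    qed
    have "tr p e (\<beta> ^ i * d l0) = 0" if "i < e" for i
      using z[of "i + 2"] that by (simp add: G2_def)
    then have "d l0 = 0" using tr_power_basis_nondegenerate[OF \<beta>] by blast
    \<comment> \<open>The trace rows leave only the point 0, but there the second row has the entry
      \<open>f 0 + 1 = 1\<close>.\<close>
    then show False using z[of 1] f_0 by (simp add: G2_def)
  qed
qed

lemma dual_params:
  "has_params p (dual_code p ((e + 2) + p ^ e) code) ((e + 2) + p ^ e) (p ^ e) 3"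
proof -
  let ?k = "e + 2" and ?A = "G2 p e f \<beta> d"
  let ?n = "?k + p ^ e"
  have q: "p ^ e > 0" using p_pos by simp
  \<comment> \<open>The last column belongs to the point 0 and is (1, 1, 0, ..., 0), the sum of the
    first two unit columns.\<close>
  define v :: "nat \<Rightarrow> 'a" where
    "v j = (if j = 0 \<or> j = 1 then - 1 else if j = ?k + (p ^ e - 1) then 1 else 0)" for j
  have "v i = - (\<Sum>l<p ^ e. ?A i l * v (?k + l))" if "i < ?k" for i
  proof -
    have "(\<Sum>l<p ^ e. ?A i l * v (?k + l)) = (\<Sum>l<p ^ e. if l = p ^ e - 1 then ?A i l else 0)"
      by (intro sum.cong) (auto simp: v_def)
    also have "\<dots> = ?A i (p ^ e - 1)" using q by simp
    also have "\<dots> = (if i = 0 \<or> i = 1 then 1 else 0)"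
      unfolding G2_def d(2) by (simp add: f_0)
    finally have sum: "(\<Sum>l<p ^ e. ?A i l * v (?k + l)) = (if i = 0 \<or> i = 1 then 1 else 0)" .
    show ?thesis unfolding sum using that by (auto simp: v_def)
  qed
  moreover have "v \<in> words p ?n"
  proof -
    have "?k + (p ^ e - 1) < ?n" using q by linarith
    then show ?thesis by (auto simp: v_def words_def)
  qed
  ultimately have v: "v \<in> dual_code p ?n code" unfolding dual_iff by blast
  have "v 0 \<noteq> 0" by (simp add: v_def)
  then have v_ne: "v \<noteq> (\<lambda>_. 0)" by auto
  have "weight ?n v \<le> card {0, 1, ?k + (p ^ e - 1)}"
    unfolding weight_def by (intro card_mono) (auto simp: v_def)
  also have "\<dots> \<le> 3" by (simp add: card_insert_if)
  finally have "min_dist ?n (dual_code p ?n code) = 3"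
    by (rule min_dist_eqI[OF finite_subset[OF dual_code_subset finite_words] v v_ne _ dual_weight_ge_3])
  then show ?thesis unfolding has_params_def
    using dual_code_subset dual_code_add card_dual by blast
qed

end

theorem theorem4p5:
  fixes p e :: nat and f :: "'a::{field,finite} \<Rightarrow> 'a" and \<epsilon> :: int
    and \<beta> :: 'a and d :: "nat \<Rightarrow> 'a"
  assumes "prime p" and "odd p" and "odd e" and "e \<ge> 3"
    and "card (UNIV :: 'a set) = p ^ e"
    and "in_RF p e f" and "weakly_regular_bent p e f \<epsilon>"
    and "\<beta> \<noteq> 0" and "\<forall>x::'a. x \<noteq> 0 \<longrightarrow> (\<exists>i::nat. \<beta> ^ i = x)"
    and "bij_betw d {0..<p ^ e} (UNIV :: 'a set)" and "d (p ^ e - 1) = 0"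
  shows "(\<epsilon> * eta0_neg1 p ^ ((e + 1) div 2) = 1 \<longrightarrow>
            has_params p (gen_code p (e + 2) (p ^ e + e + 2) (G2' p e f \<beta> d))
              (p ^ e + e + 2) (e + 2) (p ^ e - p ^ (e - 1) - p ^ ((e - 1) div 2) + 1))
       \<and> (\<epsilon> * eta0_neg1 p ^ ((e + 1) div 2) = -1 \<longrightarrow>
            has_params p (gen_code p (e + 2) (p ^ e + e + 2) (G2' p e f \<beta> d))
              (p ^ e + e + 2) (e + 2) (p ^ e - p ^ (e - 1) - p ^ ((e - 1) div 2) + 2))
       \<and> has_params p (dual_code p (p ^ e + e + 2)
              (gen_code p (e + 2) (p ^ e + e + 2) (G2' p e f \<beta> d)))
              (p ^ e + e + 2) (p ^ e) 3
       \<and> sp_almost_optimal p (p ^ e + e + 2) (p ^ e) 3"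
proof -
  interpret F: prime_power_field p e "TYPE('a)"
    by standard (use assms in auto)
  obtain fstar where "\<forall>x. f x \<in> Fp p" "\<epsilon> = 1 \<or> \<epsilon> = -1" "\<forall>b. fstar b \<in> Fp p"
    "\<forall>b. walsh p e f b = of_int \<epsilon> * sqrt_pstar p ^ e * zeta_pow p (fstar b :: 'a)"
    using assms(7) unfolding weakly_regular_bent_def by blast
  moreover have "f (- x) = f x" for x
  proof -
    obtain h where "even h" "\<forall>a\<in>Fp p. a \<noteq> 0 \<longrightarrow> (\<forall>x. f (a * x) = a ^ h * f x)"
      using assms(6) unfolding in_RF_def by blast
    \<comment> \<open>Homogeneity at the scalar -1, which lies in the prime field.\<close>
    then have "f (- 1 * x) = (- 1) ^ h * f x" using F.Fp_minus[OF F.Fp_1] by (metis neg_equal_0_iff_equal zero_neq_one)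
    then show ?thesis using \<open>even h\<close> by simp
  qed
  moreover have "f 0 = 0" using assms(6) by (simp add: in_RF_def)
  ultimately interpret bent_code p e "TYPE('a)" f fstar \<epsilon> \<beta> d
    by unfold_locales (use assms in auto)
  have len: "p ^ e + e + 2 = (e + 2) + p ^ e" by simp
  have "p \<ge> 3" using assms(1,2) prime_ge_2_nat[of p] by (cases "p = 2") auto
  then have sp: "sp_almost_optimal p (p ^ e + e + 2) (p ^ e) 3"
    using sphere_packing_bound_check assms(4) by blast
  have params: "has_params p (gen_code p (e + 2) (p ^ e + e + 2) (G2' p e f \<beta> d))
      (p ^ e + e + 2) (e + 2) (p ^ e - p ^ (e - 1) - p ^ ((e - 1) div 2) + k)"
    if "k = (if sgn_code = 1 then 1 else 2)" for k
    unfolding len G2'_eq_systematic by (rule code_params[OF that])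
  have dual: "has_params p (dual_code p (p ^ e + e + 2)
      (gen_code p (e + 2) (p ^ e + e + 2) (G2' p e f \<beta> d))) (p ^ e + e + 2) (p ^ e) 3"
    unfolding len G2'_eq_systematic by (rule dual_params)
  have "sgn_code = -1 \<Longrightarrow> (2::nat) = (if sgn_code = 1 then 1 else 2)" by simp
  with params[of 1] params[of 2] dual sp show ?thesis
    unfolding sgn_code_def[symmetric] by presburger
qed

end
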